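(* Let $(E,\rho,\langle\cdot,\cdot\rangle,[\cdot,\cdot])$ be a Courant algebroid over $M$ and let $L$ be an almost involutive structure in $E$ supported on a submanifold $S\subseteq M$. Suppose that for every $s\in S$ there is a local frame $(\sigma_\mu)_{\mu=1}^{\mathrm{rk}(L)}$ for $L$ over an open neighborhood $V\subseteq S$ of $s$ in $S$, together with an open set $U\subseteq M$ with $V\subseteq U$ and a collection $\{\psi_\mu\}_{\mu=1}^{\mathrm{rk}(L)}\subseteq\Gamma_U(E)$ satisfying $\psi_\mu|_V=\sigma_\mu$. Moreover, assume that $[\psi_\mu,\psi_\nu]\in\Gamma_U(E;L)$ for all $\mu,\nu\in\{1,\dots,\mathrm{rk}(L)\}$. Then $L$ is an involutive structure supported on $S$.
   Context: A Courant algebroid over a smooth manifold $M$ is a tuple $(E,\rho,\langle\cdot,\cdot\rangle,[\cdot,\cdot])$, where $E\to M$ is a real vector bundle of finite rank, $\rho:E\to TM$ is a vector bundle map over the identity (the anchor), $\langle\cdot,\cdot\rangle$ is a fiber-wise metric on $E$ (symmetric and non-degenerate, of arbitrary but constant signature), and $[\cdot,\cdot]$ is an $\mathbb{R}$-bilinear bracket on $\Gamma(E)$ such that for all $\psi,\psi',\psi''\in\Gamma(E)$, $f\in C^\infty(M)$: C1) $[\psi,f\psi']=f[\psi,\psi']+(\mathcal{L}_{\rho(\psi)}f)\psi'$; C2) $[\psi,[\psi',\psi'']]=[[\psi,\psi'],\psi'']+[\psi',[\psi,\psi'']]$; C3) $\mathcal{L}_{\rho(\psi)}\langle\psi',\psi''\rangle=\langle[\psi,\psi'],\psi''\rangle+\langle\psi',[\psi,\psi'']\rangle$;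 C4) $\langle[\psi,\psi],\psi'\rangle=\frac12\mathcal{L}_{\rho(\psi')}\langle\psi,\psi\rangle$. The bracket is local and restricts to sections over open subsets. Submanifolds are embedded (not necessarily closed). A subbundle of $E$ supported on a submanifold $S\subseteq M$ is a vector subbundle $L$ of the restricted bundle $E_S$; $L^\perp\subseteq E_S$ is its orthogonal complement. $\Gamma(E;L)=\{\psi\in\Gamma(E)\mid\psi|_S\in\Gamma(L)\}$; for $U\subseteq M$ open, $\Gamma_U(E)$ denotes sections of $E$ over $U$ and $\Gamma_U(E;L)$ those taking values in $L$ when restricted to $U\cap S$. $L$ is isotropic if $L\subseteq L^\perp$; compatible with the anchor if $\rho(L)\subseteq TS$; involutive if $[\psi,\psi']\in\Gamma(E;L)$ for all $\psi,\psi'\in\Gamma(E;L)$. An almost involutive structure supported on $S$ is a subbundle $L$ supported on $S$ that is isotropic and such that $L^\perp$ is compatible with the anchor; it is an involutive structure if it is moreover involutive. *)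

theory Defs
  imports "HOL-Analysis.Analysis"
begin

text \<open>
  Conventions. Functions and sections over a set \<open>U\<close> are total functions that vanish outside \<open>U\<close>,
  so that equality of sections is equality of functions; \<open>restr U f\<close> is the restriction of \<open>f\<close> to \<open>U\<close>
  in this sense. The model space \<open>\<real>\<^sup>n\<close> of a manifold, and likewise the typical fibre of a vector
  bundle, is an arbitrary linear subspace of some Euclidean space; this admits dimension and rank
  \<open>0\<close>, and makes a submanifold of \<open>M\<close> a manifold over the same types.
\<close>

definition restr :: "'m set \<Rightarrow> ('m \<Rightarrow> 'a::zero) \<Rightarrow> 'm \<Rightarrow> 'a" where
  "restr U f = (\<lambda>x. if x \<in> U then f x else 0)"

definition linear_map_on ::
  "'a::real_vector set \<Rightarrow> ('a \<Rightarrow> 'b::real_vector) \<Rightarrow> bool" where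
  "linear_map_on V f \<longleftrightarrow>
     (\<forall>x\<in>V. \<forall>y\<in>V. f (x + y) = f x + f y) \<and> (\<forall>c. \<forall>x\<in>V. f (c *\<^sub>R x) = c *\<^sub>R f x)"


section \<open>Smooth manifolds\<close>

text \<open>For open \<open>A\<close>: \<open>f\<close> is of class \<open>C\<^sup>k\<close> on \<open>A\<close>.\<close>

primrec Ck_on ::
  "nat \<Rightarrow> 'a::euclidean_space set \<Rightarrow> ('a \<Rightarrow> 'b::real_normed_vector) \<Rightarrow> bool" where
  "Ck_on 0 A f \<longleftrightarrow> continuous_on A f"
| "Ck_on (Suc k) A f \<longleftrightarrow>
     (\<forall>x\<in>A. f differentiable (at x)) \<and> (\<forall>v. Ck_on k A (\<lambda>x. frechet_derivative f (at x) v))"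

text \<open>
  Smoothness on a set that need not be open in the ambient space: local extendability. It is used
  only for sets that are relatively open in a linear subspace, where it is ordinary smoothness on an
  open subset of that subspace.
\<close>

definition smooth_on ::
  "'a::euclidean_space set \<Rightarrow> ('a \<Rightarrow> 'b::real_normed_vector) \<Rightarrow> bool" where
  "smooth_on A f \<longleftrightarrow>
     (\<forall>a\<in>A. \<exists>N F. open N \<and> a \<in> N \<and> (\<forall>k. Ck_on k N F) \<and> (\<forall>x\<in>N \<inter> A. F x = f x))"

type_synonym ('m, 'b) chart = "'m set \<times> ('m \<Rightarrow> 'b)"

record ('m, 'b) manifold =
  mtop :: "'m topology"
  model :: "'b set"
  atlas :: "('m, 'b) chart set"

definition carrier :: "('m, 'b) manifold \<Rightarrow> 'm set" where
  "carrier M = topspace (mtop M)"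

definition topological_chart :: "('m, 'b::euclidean_space) manifold \<Rightarrow> ('m, 'b) chart \<Rightarrow> bool" where
  "topological_chart M = (\<lambda>(U, \<phi>).
     openin (mtop M) U \<and> openin (top_of_set (model M)) (\<phi> ` U) \<and>
     homeomorphic_map (subtopology (mtop M) U) (top_of_set (\<phi> ` U)) \<phi>)"

definition smooth_transition :: "('m, 'b::euclidean_space) chart \<Rightarrow> ('m, 'b) chart \<Rightarrow> bool" where
  "smooth_transition = (\<lambda>(U, \<phi>) (V, \<eta>). smooth_on (\<phi> ` (U \<inter> V)) (\<eta> \<circ> inv_into U \<phi>))"

definition smooth_manifold :: "('m, 'b::euclidean_space) manifold \<Rightarrow> bool" where
  "smooth_manifold M \<longleftrightarrow>
     Hausdorff_space (mtop M) \<and> second_countable (mtop M) \<and> subspace (model M) \<and>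
     (\<forall>c\<in>atlas M. topological_chart M c) \<and>
     (\<Union>(U, \<phi>)\<in>atlas M. U) = carrier M \<and>
     (\<forall>c\<in>atlas M. \<forall>d\<in>atlas M. smooth_transition c d)"

text \<open>The charts of the maximal atlas.\<close>

definition smooth_chart :: "('m, 'b::euclidean_space) manifold \<Rightarrow> ('m, 'b) chart \<Rightarrow> bool" where
  "smooth_chart M c \<longleftrightarrow>
     topological_chart M c \<and> (\<forall>d\<in>atlas M. smooth_transition c d \<and> smooth_transition d c)"

definition smooth_map_on ::
  "('m, 'b::euclidean_space) manifold \<Rightarrow> 'm set \<Rightarrow> ('m \<Rightarrow> 'c::real_normed_vector) \<Rightarrow> bool" where
  "smooth_map_on M U f \<longleftrightarrow> (\<forall>(V, \<phi>)\<in>atlas M. smooth_on (\<phi> ` (U \<inter> V)) (f \<circ> inv_into V \<phi>))"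

definition smooth_functions :: "('m, 'b::euclidean_space) manifold \<Rightarrow> ('m \<Rightarrow> real) set" where
  "smooth_functions M = {f. smooth_map_on M (carrier M) f \<and> (\<forall>x. x \<notin> carrier M \<longrightarrow> f x = 0)}"

text \<open>
  Embedded, not necessarily closed, submanifolds: \<open>S\<close> carries the subspace topology and an atlas of
  restrictions of slice charts of \<open>M\<close>. The dimension of \<open>S\<close> is that of its model subspace.
\<close>

definition submanifold ::
  "('m, 'b::euclidean_space) manifold \<Rightarrow> ('m, 'b) manifold \<Rightarrow> bool" where
  "submanifold M S \<longleftrightarrow>
     carrier S \<subseteq> carrier M \<and> mtop S = subtopology (mtop M) (carrier S) \<and>
     subspace (model S) \<and> model S \<subseteq> model M \<and>
     (\<Union>(V, \<phi>)\<in>atlas S. V) = carrier S \<and>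
     (\<forall>(V, \<phi>)\<in>atlas S. \<exists>U. smooth_chart M (U, \<phi>) \<and>
        V = U \<inter> carrier S \<and> \<phi> ` V = \<phi> ` U \<inter> model S)"

text \<open>
  Tangent vectors are derivations of the algebra of smooth functions. They are set to \<open>0\<close> on
  arguments that are not smooth, so that they are determined by their values on smooth functions.
\<close>

definition tangent_space ::
  "('m, 'b::euclidean_space) manifold \<Rightarrow> 'm \<Rightarrow> (('m \<Rightarrow> real) \<Rightarrow> real) set" where
  "tangent_space M x = {v.
     (\<forall>f\<in>smooth_functions M. \<forall>h\<in>smooth_functions M. v (\<lambda>y. f y + h y) = v f + v h) \<and>
     (\<forall>c. \<forall>f\<in>smooth_functions M. v (\<lambda>y. c * f y) = c * v f) \<and>
     (\<forall>f\<in>smooth_functions M. \<forall>h\<in>smooth_functions M.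
        v (\<lambda>y. f y * h y) = f x * v h + h x * v f) \<and>
     (\<forall>f. f \<notin> smooth_functions M \<longrightarrow> v f = 0)}"

text \<open>\<open>T\<^sub>sS\<close> as a subspace of \<open>T\<^sub>sM\<close>: the image of the differential of the inclusion.\<close>

definition tangent_subspace ::
  "('m, 'b::euclidean_space) manifold \<Rightarrow> ('m, 'b) manifold \<Rightarrow> 'm \<Rightarrow> (('m \<Rightarrow> real) \<Rightarrow> real) set"
  where
  "tangent_subspace M S s = {v \<in> tangent_space M s.
     \<exists>w\<in>tangent_space S s. \<forall>f\<in>smooth_functions M. v f = w (restr (carrier S) f)}"


section \<open>Vector bundles\<close>

text \<open>
  The fibres form an arbitrary family of vector spaces, encoded as linear subspaces of a real vector
  space \<open>'v\<close> without topology; the position of the fibres relative to each other has no meaning.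
  A local trivialisation over \<open>U\<close> is a family \<open>\<Phi> x\<close>, \<open>x \<in> U\<close>, of linear isomorphisms of the fibres
  onto the typical fibre.
\<close>

record ('m, 'v, 'f) vbundle =
  fibre :: "'m \<Rightarrow> 'v set"
  typical_fibre :: "'f set"
  trivs :: "('m set \<times> ('m \<Rightarrow> 'v \<Rightarrow> 'f)) set"

definition vector_bundle ::
  "('m, 'b::euclidean_space) manifold \<Rightarrow>
   ('m, 'v::real_vector, 'f::euclidean_space) vbundle \<Rightarrow> bool" where
  "vector_bundle M E \<longleftrightarrow>
     subspace (typical_fibre E) \<and> (\<forall>x\<in>carrier M. subspace (fibre E x)) \<and>
     (\<forall>(U, \<Phi>)\<in>trivs E. openin (mtop M) U \<and>
        (\<forall>x\<in>U. linear_map_on (fibre E x) (\<Phi> x) \<and>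
                bij_betw (\<Phi> x) (fibre E x) (typical_fibre E))) \<and>
     (\<Union>(U, \<Phi>)\<in>trivs E. U) = carrier M \<and>
     (\<forall>(U, \<Phi>)\<in>trivs E. \<forall>(V, \<Psi>)\<in>trivs E. \<forall>w\<in>typical_fibre E.
        smooth_map_on M (U \<inter> V) (\<lambda>x. \<Psi> x (inv_into (fibre E x) (\<Phi> x) w)))"

definition sections ::
  "('m, 'b::euclidean_space) manifold \<Rightarrow>
   ('m, 'v::real_vector, 'f::euclidean_space) vbundle \<Rightarrow> 'm set \<Rightarrow> ('m \<Rightarrow> 'v) set" where
  "sections M E U = {\<psi>. (\<forall>x\<in>U. \<psi> x \<in> fibre E x) \<and> (\<forall>x. x \<notin> U \<longrightarrow> \<psi> x = 0) \<and>
     (\<forall>(V, \<Phi>)\<in>trivs E. smooth_map_on M (U \<inter> V) (\<lambda>x. \<Phi> x (\<psi> x)))}"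

definition restrict_bundle ::
  "('m, 'v, 'f) vbundle \<Rightarrow> ('m, 'b) manifold \<Rightarrow> ('m, 'v, 'f) vbundle" where
  "restrict_bundle E S = E\<lparr>trivs := (\<lambda>(U, \<Phi>). (U \<inter> carrier S, \<Phi>)) ` trivs E\<rparr>"

text \<open>Subbundles are families of linear subspaces of the fibres, and \<open>r\<close> is their rank.\<close>

definition local_frame ::
  "('m, 'b::euclidean_space) manifold \<Rightarrow> ('m, 'v::real_vector, 'f::euclidean_space) vbundle \<Rightarrow>
   ('m \<Rightarrow> 'v set) \<Rightarrow> nat \<Rightarrow> 'm set \<Rightarrow> (nat \<Rightarrow> 'm \<Rightarrow> 'v) \<Rightarrow> bool" where
  "local_frame M E L r V \<sigma> \<longleftrightarrow>
     openin (mtop M) V \<and> (\<forall>\<mu><r. \<sigma> \<mu> \<in> sections M E V) \<and>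
     (\<forall>x\<in>V. inj_on (\<lambda>\<mu>. \<sigma> \<mu> x) {..<r} \<and> independent ((\<lambda>\<mu>. \<sigma> \<mu> x) ` {..<r}) \<and>
              span ((\<lambda>\<mu>. \<sigma> \<mu> x) ` {..<r}) = L x)"

definition subbundle ::
  "('m, 'b::euclidean_space) manifold \<Rightarrow> ('m, 'v::real_vector, 'f::euclidean_space) vbundle \<Rightarrow>
   ('m \<Rightarrow> 'v set) \<Rightarrow> nat \<Rightarrow> bool" where
  "subbundle M E L r \<longleftrightarrow>
     (\<forall>x\<in>carrier M. subspace (L x) \<and> L x \<subseteq> fibre E x) \<and>
     (\<forall>x\<in>carrier M. \<exists>V \<sigma>. x \<in> V \<and> local_frame M E L r V \<sigma>)"

definition subbundle_sections ::
  "('m, 'b::euclidean_space) manifold \<Rightarrow> ('m, 'v::real_vector, 'f::euclidean_space) vbundle \<Rightarrow>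
   ('m \<Rightarrow> 'v set) \<Rightarrow> 'm set \<Rightarrow> ('m \<Rightarrow> 'v) set" where
  "subbundle_sections M E L U = {\<psi> \<in> sections M E U. \<forall>x\<in>U. \<psi> x \<in> L x}"

text \<open>\<open>\<Gamma>\<^sub>U(E;L)\<close> for \<open>L\<close> supported on \<open>S\<close>; \<open>\<Gamma>(E;L)\<close> is the case \<open>U = carrier M\<close>.\<close>

definition sections_into ::
  "('m, 'b::euclidean_space) manifold \<Rightarrow> ('m, 'v::real_vector, 'f::euclidean_space) vbundle \<Rightarrow>
   ('m, 'b) manifold \<Rightarrow> ('m \<Rightarrow> 'v set) \<Rightarrow> 'm set \<Rightarrow> ('m \<Rightarrow> 'v) set" where
  "sections_into M E S L U = {\<psi> \<in> sections M E U.
     restr (U \<inter> carrier S) \<psi> \<in> subbundle_sections S (restrict_bundle E S) L (U \<inter> carrier S)}"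


section \<open>Courant algebroids\<close>

type_synonym ('m, 'v) anchor = "'m \<Rightarrow> 'v \<Rightarrow> ('m \<Rightarrow> real) \<Rightarrow> real"
type_synonym ('m, 'v) metric = "'m \<Rightarrow> 'v \<Rightarrow> 'v \<Rightarrow> real"
type_synonym ('m, 'v) bracket = "('m \<Rightarrow> 'v) \<Rightarrow> ('m \<Rightarrow> 'v) \<Rightarrow> 'm \<Rightarrow> 'v"

definition lie_derivative ::
  "('m, 'b) manifold \<Rightarrow> ('m, 'v) anchor \<Rightarrow> ('m \<Rightarrow> 'v) \<Rightarrow> ('m \<Rightarrow> real) \<Rightarrow> 'm \<Rightarrow> real" where
  "lie_derivative M \<rho> \<psi> f = restr (carrier M) (\<lambda>x. \<rho> x (\<psi> x) f)"

definition pairing ::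
  "('m, 'b) manifold \<Rightarrow> ('m, 'v) metric \<Rightarrow> ('m \<Rightarrow> 'v) \<Rightarrow> ('m \<Rightarrow> 'v) \<Rightarrow> 'm \<Rightarrow> real" where
  "pairing M g \<psi> \<psi>' = restr (carrier M) (\<lambda>x. g x (\<psi> x) (\<psi>' x))"

text \<open>
  Smoothness of the anchor: sections are mapped to smooth vector fields, that is, to fields of
  tangent vectors taking smooth functions to smooth functions.
\<close>

definition anchor_map ::
  "('m, 'b::euclidean_space) manifold \<Rightarrow> ('m, 'v::real_vector, 'f::euclidean_space) vbundle \<Rightarrow>
   ('m, 'v) anchor \<Rightarrow> bool" where
  "anchor_map M E \<rho> \<longleftrightarrow>
     (\<forall>x\<in>carrier M. (\<forall>e\<in>fibre E x. \<rho> x e \<in> tangent_space M x) \<and>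
        (\<forall>f. linear_map_on (fibre E x) (\<lambda>e. \<rho> x e f))) \<and>
     (\<forall>\<psi>\<in>sections M E (carrier M). \<forall>f\<in>smooth_functions M.
        lie_derivative M \<rho> \<psi> f \<in> smooth_functions M)"

definition has_signature ::
  "'v::real_vector set \<Rightarrow> ('v \<Rightarrow> 'v \<Rightarrow> real) \<Rightarrow> nat \<Rightarrow> nat \<Rightarrow> bool" where
  "has_signature V b p q \<longleftrightarrow>
     (\<exists>e. inj_on e {..<p + q} \<and> independent (e ` {..<p + q}) \<and> span (e ` {..<p + q}) = V \<and>
       (\<forall>i<p + q. \<forall>j<p + q. b (e i) (e j) = (if i \<noteq> j then 0 else if i < p then 1 else - 1)))"

definition fibre_metric ::
  "('m, 'b::euclidean_space) manifold \<Rightarrow> ('m, 'v::real_vector, 'f::euclidean_space) vbundle \<Rightarrow>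
   ('m, 'v) metric \<Rightarrow> bool" where
  "fibre_metric M E g \<longleftrightarrow>
     (\<forall>x\<in>carrier M.
        (\<forall>e\<in>fibre E x. linear_map_on (fibre E x) (g x e)) \<and>
        (\<forall>e\<in>fibre E x. \<forall>e'\<in>fibre E x. g x e e' = g x e' e) \<and>
        (\<forall>e\<in>fibre E x. (\<forall>e'\<in>fibre E x. g x e e' = 0) \<longrightarrow> e = 0)) \<and>
     (\<exists>p q. \<forall>x\<in>carrier M. has_signature (fibre E x) (g x) p q) \<and>
     (\<forall>\<psi>\<in>sections M E (carrier M). \<forall>\<psi>'\<in>sections M E (carrier M).
        pairing M g \<psi> \<psi>' \<in> smooth_functions M)"

definition bilinear_bracket ::
  "('m, 'b::euclidean_space) manifold \<Rightarrow> ('m, 'v::real_vector, 'f::euclidean_space) vbundle \<Rightarrow>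
   ('m, 'v) bracket \<Rightarrow> bool" where
  "bilinear_bracket M E br \<longleftrightarrow> (let \<Gamma> = sections M E (carrier M) in
     (\<forall>\<psi>\<in>\<Gamma>. \<forall>\<psi>'\<in>\<Gamma>. br \<psi> \<psi>' \<in> \<Gamma>) \<and>
     (\<forall>a b. \<forall>\<psi>\<in>\<Gamma>. \<forall>\<psi>'\<in>\<Gamma>. \<forall>\<psi>''\<in>\<Gamma>.
        br (\<lambda>x. a *\<^sub>R \<psi> x + b *\<^sub>R \<psi>' x) \<psi>'' = (\<lambda>x. a *\<^sub>R br \<psi> \<psi>'' x + b *\<^sub>R br \<psi>' \<psi>'' x) \<and>
        br \<psi>'' (\<lambda>x. a *\<^sub>R \<psi> x + b *\<^sub>R \<psi>' x) = (\<lambda>x. a *\<^sub>R br \<psi>'' \<psi> x + b *\<^sub>R br \<psi>'' \<psi>' x)))"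

definition courant_algebroid ::
  "('m, 'b::euclidean_space) manifold \<Rightarrow> ('m, 'v::real_vector, 'f::euclidean_space) vbundle \<Rightarrow>
   ('m, 'v) anchor \<Rightarrow> ('m, 'v) metric \<Rightarrow> ('m, 'v) bracket \<Rightarrow> bool" where
  "courant_algebroid M E \<rho> g br \<longleftrightarrow>
     smooth_manifold M \<and> vector_bundle M E \<and> anchor_map M E \<rho> \<and> fibre_metric M E g \<and>
     bilinear_bracket M E br \<and>
     (let \<Gamma> = sections M E (carrier M); \<L> = lie_derivative M \<rho>; pr = pairing M g in
       (\<forall>\<psi>\<in>\<Gamma>. \<forall>\<psi>'\<in>\<Gamma>. \<forall>f\<in>smooth_functions M.
          br \<psi> (\<lambda>x. f x *\<^sub>R \<psi>' x) = (\<lambda>x. f x *\<^sub>R br \<psi> \<psi>' x + \<L> \<psi> f x *\<^sub>R \<psi>' x)) \<and>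
       (\<forall>\<psi>\<in>\<Gamma>. \<forall>\<psi>'\<in>\<Gamma>. \<forall>\<psi>''\<in>\<Gamma>.
          br \<psi> (br \<psi>' \<psi>'') = (\<lambda>x. br (br \<psi> \<psi>') \<psi>'' x + br \<psi>' (br \<psi> \<psi>'') x)) \<and>
       (\<forall>\<psi>\<in>\<Gamma>. \<forall>\<psi>'\<in>\<Gamma>. \<forall>\<psi>''\<in>\<Gamma>.
          \<L> \<psi> (pr \<psi>' \<psi>'') = (\<lambda>x. pr (br \<psi> \<psi>') \<psi>'' x + pr \<psi>' (br \<psi> \<psi>'') x)) \<and>
       (\<forall>\<psi>\<in>\<Gamma>. \<forall>\<psi>'\<in>\<Gamma>. pr (br \<psi> \<psi>) \<psi>' = (\<lambda>x. 1 / 2 * \<L> \<psi>' (pr \<psi> \<psi>) x)))"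

text \<open>
  The bracket induced on sections over an open set \<open>U\<close>. By locality of the bracket, which follows
  from the axioms, its value at \<open>x\<close> is the value of the bracket of any two global sections that agree
  with the given ones near \<open>x\<close>.
\<close>

definition local_bracket ::
  "('m, 'b::euclidean_space) manifold \<Rightarrow> ('m, 'v::real_vector, 'f::euclidean_space) vbundle \<Rightarrow>
   ('m, 'v) bracket \<Rightarrow> 'm set \<Rightarrow> ('m, 'v) bracket" where
  "local_bracket M E br U \<psi> \<psi>' = restr U (\<lambda>x. THE v.
     \<exists>\<phi>\<in>sections M E (carrier M). \<exists>\<phi>'\<in>sections M E (carrier M).
       (\<exists>N. openin (mtop M) N \<and> x \<in> N \<and> N \<subseteq> U \<and> (\<forall>y\<in>N. \<phi> y = \<psi> y \<and> \<phi>' y = \<psi>' y)) \<and>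
       v = br \<phi> \<phi>' x)"


section \<open>Involutive structures\<close>

definition orth ::
  "('m, 'v, 'f) vbundle \<Rightarrow> ('m, 'v) metric \<Rightarrow> ('m \<Rightarrow> 'v set) \<Rightarrow> 'm \<Rightarrow> 'v set" where
  "orth E g L s = {e \<in> fibre E s. \<forall>l\<in>L s. g s e l = 0}"

definition isotropic ::
  "('m, 'v, 'f) vbundle \<Rightarrow> ('m, 'v) metric \<Rightarrow> ('m, 'b) manifold \<Rightarrow> ('m \<Rightarrow> 'v set) \<Rightarrow> bool" where
  "isotropic E g S L \<longleftrightarrow> (\<forall>s\<in>carrier S. L s \<subseteq> orth E g L s)"

definition compatible_with_anchor ::
  "('m, 'b::euclidean_space) manifold \<Rightarrow> ('m, 'v) anchor \<Rightarrow> ('m, 'b) manifold \<Rightarrow>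
   ('m \<Rightarrow> 'v set) \<Rightarrow> bool" where
  "compatible_with_anchor M \<rho> S L \<longleftrightarrow> (\<forall>s\<in>carrier S. \<rho> s ` L s \<subseteq> tangent_subspace M S s)"

definition involutive ::
  "('m, 'b::euclidean_space) manifold \<Rightarrow> ('m, 'v::real_vector, 'f::euclidean_space) vbundle \<Rightarrow>
   ('m, 'v) bracket \<Rightarrow> ('m, 'b) manifold \<Rightarrow> ('m \<Rightarrow> 'v set) \<Rightarrow> bool" where
  "involutive M E br S L \<longleftrightarrow>
     (\<forall>\<psi>\<in>sections_into M E S L (carrier M). \<forall>\<psi>'\<in>sections_into M E S L (carrier M).
        br \<psi> \<psi>' \<in> sections_into M E S L (carrier M))"

definition almost_involutive_structure ::
  "('m, 'b::euclidean_space) manifold \<Rightarrow> ('m, 'v::real_vector, 'f::euclidean_space) vbundle \<Rightarrow>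
   ('m, 'v) anchor \<Rightarrow> ('m, 'v) metric \<Rightarrow> ('m, 'b) manifold \<Rightarrow> ('m \<Rightarrow> 'v set) \<Rightarrow> nat \<Rightarrow> bool" where
  "almost_involutive_structure M E \<rho> g S L r \<longleftrightarrow>
     submanifold M S \<and> subbundle S (restrict_bundle E S) L r \<and>
     isotropic E g S L \<and> compatible_with_anchor M \<rho> S (orth E g L)"

definition involutive_structure ::
  "('m, 'b::euclidean_space) manifold \<Rightarrow> ('m, 'v::real_vector, 'f::euclidean_space) vbundle \<Rightarrow>
   ('m, 'v) anchor \<Rightarrow> ('m, 'v) metric \<Rightarrow> ('m, 'v) bracket \<Rightarrow>
   ('m, 'b) manifold \<Rightarrow> ('m \<Rightarrow> 'v set) \<Rightarrow> nat \<Rightarrow> bool" where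
  "involutive_structure M E \<rho> g br S L r \<longleftrightarrow>
     almost_involutive_structure M E \<rho> g S L r \<and> involutive M E br S L"

end

theory Submission
  imports Defs
begin

text \<open>
  Let \<open>\<psi>, \<psi>'\<close> be sections of \<open>E\<close> with values in \<open>L\<close> along \<open>S\<close>, and \<open>s \<in> S\<close>. The metric is
  non-degenerate, so \<open>L\<^sub>s = L\<^sub>s\<^sup>\<bottom>\<^sup>\<bottom>\<close> (\<open>mem_span_if_orthogonal\<close>), and it suffices to show that \<open>[\<psi>,\<psi>']\<close> is
  orthogonal at \<open>s\<close> to every vector of \<open>L\<^sub>s\<^sup>\<bottom>\<close>. Such a vector extends to a global section \<open>e\<close> that is
  orthogonal to the given frame near \<open>s\<close> (\<open>orthogonal_extension\<close>), and the number
  \<open>T(\<psi>,\<psi>') = \<langle>[\<psi>,\<psi>'],e\<rangle>(s)\<close> has two properties.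

  Firstly, compatibility of the bracket with the metric gives
  \<open>\<rho>(\<psi>)\<langle>\<psi>',e\<rangle> = \<langle>[\<psi>,\<psi>'],e\<rangle> + \<langle>\<psi>',[\<psi>,e]\<rangle>\<close>. The function \<open>\<langle>\<psi>',e\<rangle>\<close> vanishes on \<open>S\<close> near \<open>s\<close>, and \<open>\<rho>(\<psi>)\<close>
  is tangent to \<open>S\<close> at \<open>s\<close> because \<open>L \<subseteq> L\<^sup>\<bottom>\<close>. Hence \<open>T(\<psi>,\<psi>') = - \<langle>\<psi>',[\<psi>,e]\<rangle>(s)\<close> depends on \<open>\<psi>'\<close> only
  through \<open>\<psi>'(s)\<close>, and linearly. Secondly, the symmetric part of the bracket satisfies
  \<open>\<langle>[\<psi>,\<psi>'] + [\<psi>',\<psi>],e\<rangle> = \<rho>(e)\<langle>\<psi>,\<psi>'\<rangle>\<close>. By isotropy \<open>\<langle>\<psi>,\<psi>'\<rangle>\<close> vanishes on \<open>S\<close>, and \<open>\<rho>(e)\<close> is tangent to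
  \<open>S\<close> at \<open>s\<close>, so \<open>T\<close> is skew. Therefore \<open>T\<close> is a bilinear form in \<open>\<psi>(s)\<close> and \<open>\<psi>'(s)\<close>, which vanishes on the
  frame by hypothesis, and so \<open>T = 0\<close> (\<open>bracket_in_subbundle_at\<close>).

  The analysis around this argument consists of closure properties of smooth maps, bump functions,
  the restriction of smooth maps to \<open>S\<close>, and the locality of the bracket, which relates the frame
  over \<open>U\<close> to global sections (\<open>local_bracket_eq\<close>, \<open>globalise_frame\<close>).
\<close>

section \<open>Calculus of maps of finite differentiability order\<close>

lemma Ck_on_subset: "Ck_on k A f \<Longrightarrow> B \<subseteq> A \<Longrightarrow> Ck_on k B f"
proof (induction k arbitrary: f)
  case 0
  then show ?case using continuous_on_subset by auto
next
  case (Suc k)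
  then show ?case by auto
qed

lemma Ck_on_cong:
  assumes "open A" and "\<And>x. x \<in> A \<Longrightarrow> f x = f' x" and "Ck_on k A f"
  shows "Ck_on k A f'"
  using assms(2,3)
proof (induction k arbitrary: f f')
  case 0
  then show ?case using continuous_on_cong by force
next
  case (Suc k)
  have der: "(f has_derivative D) (at x) \<longleftrightarrow> (f' has_derivative D) (at x)" if "x \<in> A" for x D
    using has_derivative_transform_within_open[OF _ assms(1) that] Suc.prems(1) by metis
  have "frechet_derivative f (at x) = frechet_derivative f' (at x)" if "x \<in> A" for x
    unfolding frechet_derivative_def using der[OF that] by simp
  moreover have "f' differentiable (at x)" if "x \<in> A" for x
  proof -
    have "f differentiable (at x)" using Suc.prems(2) that by simp
    then show ?thesis using der[OF that] by (simp add: differentiable_def)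
  qed
  ultimately show ?case
    using Suc.prems(2) Suc.IH[of "\<lambda>x. frechet_derivative f (at x) v" "\<lambda>x. frechet_derivative f' (at x) v" for v]
    by simp
qed

text \<open>
  The defining recursion speaks of the chosen derivative \<^const>\<open>frechet_derivative\<close>; on an open set
  any derivative given by a formula may take its place, which is how the closure properties
  below are proved.
\<close>

lemma Ck_on_SucI:
  assumes "open A" and "\<And>x. x \<in> A \<Longrightarrow> (f has_derivative D x) (at x)"
    and "\<And>v. Ck_on k A (\<lambda>x. D x v)"
  shows "Ck_on (Suc k) A f"
proof -
  have "frechet_derivative f (at x) = D x" if "x \<in> A" for x
    using frechet_derivative_at[OF assms(2)[OF that]] by simp
  then have "Ck_on k A (\<lambda>x. frechet_derivative f (at x) v)" for v
    using Ck_on_cong[OF assms(1) _ assms(3)[of v]] by simp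
  then show ?thesis using assms(2) by (auto simp: differentiable_def)
qed

lemma Ck_on_SucD:
  assumes "Ck_on (Suc k) A f" and "x \<in> A"
  shows "(f has_derivative frechet_derivative f (at x)) (at x)"
  using assms frechet_derivative_works by auto

lemma Ck_on_lower: "Ck_on (Suc k) A f \<Longrightarrow> Ck_on k A f"
proof (induction k arbitrary: f)
  case 0
  then show ?case
    by (auto intro!: continuous_at_imp_continuous_on differentiable_imp_continuous_within)
next
  case (Suc k)
  then show ?case by (metis Ck_on.simps(2))
qed

lemma Ck_on_const: "open A \<Longrightarrow> Ck_on k A (\<lambda>x. c)"
  by (induction k arbitrary: c)
    (auto simp: frechet_derivative_const)

lemma Ck_on_add:
  assumes "open A" "Ck_on k A f" "Ck_on k A h"
  shows "Ck_on k A (\<lambda>x. f x + h x)"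
  using assms(2,3)
proof (induction k arbitrary: f h)
  case 0
  then show ?case by (auto intro: continuous_on_add)
next
  case (Suc k)
  show ?case
  proof (rule Ck_on_SucI[OF assms(1)])
    show "((\<lambda>x. f x + h x) has_derivative
        (\<lambda>v. frechet_derivative f (at x) v + frechet_derivative h (at x) v)) (at x)" if "x \<in> A" for x
      using has_derivative_add Ck_on_SucD that Suc.prems by blast
  qed (use Suc in auto)
qed

lemma Ck_on_sum:
  assumes "open A" "\<And>i. i \<in> I \<Longrightarrow> Ck_on k A (f i)"
  shows "Ck_on k A (\<lambda>x. \<Sum>i\<in>I. f i x)"
  using assms(2)
  by (induction I rule: infinite_finite_induct) (auto intro: Ck_on_const Ck_on_add assms(1))

lemma (in bounded_linear) Ck_on_image:
  assumes "open A" "Ck_on k A h"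
  shows "Ck_on k A (\<lambda>x. f (h x))"
  using assms(2)
proof (induction k arbitrary: h)
  case 0
  then show ?case by (auto intro: continuous_on)
next
  case (Suc k)
  show ?case
  proof (rule Ck_on_SucI[OF assms(1)])
    show "((\<lambda>x. f (h x)) has_derivative (\<lambda>v. f (frechet_derivative h (at x) v))) (at x)" if "x \<in> A" for x
      using has_derivative Ck_on_SucD[OF Suc.prems that] by blast
  qed (use Suc in auto)
qed

text \<open>
  Induction on the order through the product rule: both summands of the derivative are again
  products of maps that are one order less smooth. Instances are scalar multiplication and the inner
  product.
\<close>

lemma (in bounded_bilinear) Ck_on_image2:
  assumes "open A" "Ck_on k A f" "Ck_on k A h"
  shows "Ck_on k A (\<lambda>x. prod (f x) (h x))"
  using assms(2,3)
proof (induction k arbitrary: f h)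
  case 0
  then show ?case by (auto intro: continuous_on)
next
  case (Suc k)
  show ?case
  proof (rule Ck_on_SucI[OF assms(1)])
    show "((\<lambda>x. prod (f x) (h x)) has_derivative
        (\<lambda>v. prod (f x) (frechet_derivative h (at x) v) + prod (frechet_derivative f (at x) v) (h x)))
        (at x)" if "x \<in> A" for x
      using FDERIV[OF Ck_on_SucD[OF Suc.prems(1) that] Ck_on_SucD[OF Suc.prems(2) that]] .
    show "Ck_on k A (\<lambda>x. prod (f x) (frechet_derivative h (at x) v) +
        prod (frechet_derivative f (at x) v) (h x))" for v
      using Suc.IH Suc.prems Ck_on_lower[OF Suc.prems(1)] Ck_on_lower[OF Suc.prems(2)]
      by (intro Ck_on_add[OF assms(1)]) auto
  qed
qed

lemma Ck_on_linear:
  assumes "open A" "bounded_linear f"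
  shows "Ck_on k A f"
proof (cases k)
  case 0
  then show ?thesis using assms by (simp add: linear_continuous_on)
next
  case (Suc j)
  show ?thesis unfolding Suc
    by (rule Ck_on_SucI[OF assms(1) bounded_linear_imp_has_derivative[OF assms(2)]])
      (rule Ck_on_const[OF assms(1)])
qed

text \<open>
  Expanding the chain rule in an orthonormal basis writes each directional derivative of the
  composite as a sum of products of a coordinate of the derivative of \<open>h\<close> and a partial derivative
  of \<open>f\<close> composed with \<open>h\<close>, so that the induction on the order closes.
\<close>

lemma Ck_on_compose:
  fixes h :: "'a::euclidean_space \<Rightarrow> 'b::euclidean_space"
    and f :: "'b \<Rightarrow> 'c::real_normed_vector"
  assumes "open A" "open B" "h ` A \<subseteq> B" "Ck_on k A h" "Ck_on k B f"
  shows "Ck_on k A (\<lambda>x. f (h x))"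
  using assms(4,5)
proof (induction k arbitrary: f)
  case 0
  then show ?case using continuous_on_compose2 assms(3) by auto
next
  case (Suc k)
  let ?D = "\<lambda>x v. \<Sum>i\<in>Basis. (frechet_derivative h (at x) v \<bullet> i) *\<^sub>R frechet_derivative f (at (h x)) i"
  have D: "?D x v = frechet_derivative f (at (h x)) (frechet_derivative h (at x) v)" if "x \<in> A" for x v
  proof -
    have "linear (frechet_derivative f (at (h x)))"
      using Ck_on_SucD[OF Suc.prems(2)] that assms(3) has_derivative_linear by blast
    then show ?thesis
      using linear_sum[of "frechet_derivative f (at (h x))"
          "\<lambda>i. (frechet_derivative h (at x) v \<bullet> i) *\<^sub>R i" Basis]
      by (simp add: euclidean_representation linear_cmul)
  qed
  show ?case
  proof (rule Ck_on_SucI[OF assms(1)])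
    show "((\<lambda>x. f (h x)) has_derivative ?D x) (at x)" if "x \<in> A" for x
    proof -
      have "h x \<in> B" using that assms(3) by auto
      then have "(f \<circ> h has_derivative
          frechet_derivative f (at (h x)) \<circ> frechet_derivative h (at x)) (at x)"
        using diff_chain_at[OF Ck_on_SucD[OF Suc.prems(1) that] Ck_on_SucD[OF Suc.prems(2)]] by simp
      then show ?thesis using D[OF that] by (simp add: o_def)
    qed
    show "Ck_on k A (\<lambda>x. ?D x v)" for v
    proof (intro Ck_on_sum[OF assms(1)] bounded_bilinear.Ck_on_image2[OF bounded_bilinear_scaleR assms(1)])
      fix i :: 'b
      show "Ck_on k A (\<lambda>x. frechet_derivative h (at x) v \<bullet> i)"
        using bounded_linear.Ck_on_image[OF bounded_linear_inner_left assms(1)] Suc.prems(1)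
        unfolding Ck_on.simps by blast
      show "Ck_on k A (\<lambda>x. frechet_derivative f (at (h x)) i)"
        using Suc.IH[OF Ck_on_lower[OF Suc.prems(1)], of "\<lambda>y. frechet_derivative f (at y) i"] Suc.prems(2)
        by simp
    qed
  qed
qed

section \<open>Smooth bump functions on Euclidean space\<close>

text \<open>
  The family \<open>t\<^sup>-\<^sup>n exp (- 1 / t)\<close>, continued by \<open>0\<close>. The function of interest is \<open>flat 0\<close>; the
  family is considered because its span is closed under differentiation.
\<close>

definition flat :: "nat \<Rightarrow> real \<Rightarrow> real" where
  "flat n t = (if t \<le> 0 then 0 else inverse t ^ n * exp (- inverse t))"

lemma flat_has_derivative:
  "(flat n has_real_derivative flat (n + 2) t - n * flat (n + 1) t) (at t)"
proof (cases t "0::real" rule: linorder_cases)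
  case less
  have "((\<lambda>_. 0) has_real_derivative 0) (at t)" by simp
  moreover have "\<forall>\<^sub>F x in nhds t. 0 = flat n x"
    using eventually_nhds_in_open[of "{..<0}" t] less by (auto simp: flat_def elim!: eventually_mono)
  ultimately show ?thesis
    using less DERIV_cong_ev[of t t "\<lambda>_. 0" "flat n" 0 0] by (simp add: flat_def)
next
  case greater
  let ?f = "\<lambda>t::real. inverse t ^ n * exp (- inverse t)"
  have "(?f has_real_derivative
      inverse t ^ (n + 2) * exp (- inverse t) - n * (inverse t ^ (n + 1) * exp (- inverse t))) (at t)"
    using greater
  proof -
    have inv: "(inverse has_real_derivative - (inverse t ^ 2)) (at t)"
      using greater by (auto intro!: derivative_eq_intros simp: power2_eq_square)
    have "((\<lambda>t. inverse t ^ n) has_real_derivative - (n * inverse t ^ (n + 1))) (at t)"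
      using DERIV_power[OF inv, of n]
      by (cases n) (simp_all add: power2_eq_square mult_ac)
    moreover have "((\<lambda>t. exp (- inverse t)) has_real_derivative inverse t ^ 2 * exp (- inverse t)) (at t)"
      using DERIV_chain2[OF DERIV_exp DERIV_minus[OF inv]] by (simp add: mult_ac)
    ultimately show ?thesis
      by (rule DERIV_cong[OF DERIV_mult]) (simp add: power2_eq_square algebra_simps)
  qed
  moreover have "\<forall>\<^sub>F x in nhds t. ?f x = flat n x"
    using eventually_nhds_in_open[of "{0<..}" t] greater by (auto simp: flat_def elim!: eventually_mono)
  ultimately show ?thesis
    using greater DERIV_cong_ev[of t t ?f "flat n"] by (simp add: flat_def)
next
  case equal
  \<comment> \<open>at the origin the difference quotient from the right tends to \<open>0\<close> since exponentials beat powers\<close>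
  have "((\<lambda>h::real. inverse h ^ Suc n * exp (- inverse h)) \<longlongrightarrow> 0) (at_right 0)"
  proof -
    have "((\<lambda>x::real. x ^ Suc n / exp x) \<longlongrightarrow> 0) at_top" by (rule tendsto_power_div_exp_0)
    then have "((\<lambda>x::real. inverse x ^ Suc n / exp (inverse x)) \<longlongrightarrow> 0) (at_right 0)"
      using filterlim_compose filterlim_inverse_at_top_right by blast
    then show ?thesis by (simp add: exp_minus divide_inverse)
  qed
  then have R: "((\<lambda>h. (flat n (0 + h) - flat n 0) / h) \<longlongrightarrow> 0) (at_right 0)"
    by (rule Lim_transform_eventually)
      (auto simp: eventually_at_filter flat_def field_simps)
  have L: "((\<lambda>h. (flat n (0 + h) - flat n 0) / h) \<longlongrightarrow> 0) (at_left 0)"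
    by (rule Lim_transform_eventually[OF tendsto_const])
      (auto simp: eventually_at_filter flat_def)
  have "(flat n has_real_derivative 0) (at 0)"
    unfolding DERIV_def using L R filterlim_at_split by blast
  then show ?thesis using equal by (simp add: flat_def)
qed

lemma Ck_on_flat: "Ck_on k UNIV (flat n)"
proof (induction k arbitrary: n)
  case 0
  then show ?case
    using DERIV_isCont[OF flat_has_derivative] by (simp add: continuous_at_imp_continuous_on)
next
  case (Suc k)
  show ?case
  proof (rule Ck_on_SucI)
    show "(flat n has_derivative (\<lambda>v. v *\<^sub>R (flat (n + 2) x + (- real n) *\<^sub>R flat (n + 1) x))) (at x)" for x
      using flat_has_derivative[of n x]
      by (rule has_derivative_eq_rhs[OF iffD1[OF has_field_derivative_def]])
        (simp add: fun_eq_iff algebra_simps)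
    show "Ck_on k UNIV (\<lambda>x. v *\<^sub>R (flat (n + 2) x + (- real n) *\<^sub>R flat (n + 1) x))" for v
      by (intro Ck_on_add bounded_linear.Ck_on_image[OF bounded_linear_scaleR_right] Suc open_UNIV)
  qed simp
qed

text \<open>
  The cut-off \<open>q t = flat 0 (1 - flat 0 t / flat 0 T) / flat 0 1\<close> equals \<open>1\<close> for \<open>t \<le> 0\<close> and \<open>0\<close> for
  \<open>t \<ge> T\<close>. Its only denominators are constants, so that it is smooth as a composition of
  affine maps with \<open>flat 0\<close>. The bump is \<open>q\<close> of the squared distance, shifted by \<open>\<delta>\<^sup>2\<close>.
\<close>

lemma bump_function:
  fixes a :: "'a::euclidean_space"
  assumes "0 < \<epsilon>"
  obtains \<beta> :: "'a \<Rightarrow> real" and \<delta> where "0 < \<delta>" "\<forall>k. Ck_on k UNIV \<beta>"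
    "\<forall>z\<in>ball a \<delta>. \<beta> z = 1" "\<forall>z. z \<notin> cball a \<epsilon> \<longrightarrow> \<beta> z = 0"
proof -
  define \<delta> where "\<delta> = \<epsilon> / 2"
  define T where "T = \<epsilon>\<^sup>2 - \<delta>\<^sup>2"
  have "\<delta>\<^sup>2 < \<epsilon>\<^sup>2"
    unfolding \<delta>_def using assms by (intro power_strict_mono) auto
  then have T: "0 < T" by (simp add: T_def)
  define q where "q t = inverse (flat 0 1) *\<^sub>R flat 0 (1 + (- inverse (flat 0 T)) *\<^sub>R flat 0 t)" for t
  define \<beta> where "\<beta> z = q ((z + - a) \<bullet> (z + - a) + - \<delta>\<^sup>2)" for z
  have q: "Ck_on k UNIV q" for k
  proof -
    have "Ck_on k UNIV (\<lambda>t. 1 + (- inverse (flat 0 T)) *\<^sub>R flat 0 t)"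
      by (intro bounded_linear.Ck_on_image[OF bounded_linear_scaleR_right] Ck_on_add Ck_on_const
          Ck_on_flat open_UNIV)
    then have "Ck_on k UNIV (\<lambda>t. flat 0 (1 + (- inverse (flat 0 T)) *\<^sub>R flat 0 t))"
      by (rule Ck_on_compose[OF open_UNIV open_UNIV subset_UNIV _ Ck_on_flat])
    then show ?thesis
      unfolding q_def by (rule bounded_linear.Ck_on_image[OF bounded_linear_scaleR_right open_UNIV])
  qed
  have shift: "Ck_on k UNIV (\<lambda>z::'a. z + - a)" for k
    by (rule Ck_on_add[OF open_UNIV Ck_on_linear[OF open_UNIV bounded_linear_ident]
          Ck_on_const[OF open_UNIV]])
  have "Ck_on k UNIV (\<lambda>z::'a. (z + - a) \<bullet> (z + - a) + - \<delta>\<^sup>2)" for k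
    by (rule Ck_on_add[OF open_UNIV bounded_bilinear.Ck_on_image2[OF bounded_bilinear_inner
            open_UNIV shift shift] Ck_on_const[OF open_UNIV]])
  then have smooth: "\<forall>k. Ck_on k UNIV \<beta>"
    unfolding \<beta>_def using Ck_on_compose[OF open_UNIV open_UNIV subset_UNIV _ q] by blast
  have mono: "flat 0 T \<le> flat 0 t" if "T \<le> t" for t
    using that T by (simp add: flat_def)
  have pos: "0 < flat 0 T" "0 < flat 0 1" using T by (auto simp: flat_def)
  have sq: "(z + - a) \<bullet> (z + - a) = (dist a z)\<^sup>2" for z
    by (simp add: dist_norm power2_norm_eq_inner inner_diff inner_commute)
  have "\<beta> z = 1" if "z \<in> ball a \<delta>" for z
  proof -
    have "(dist a z)\<^sup>2 \<le> \<delta>\<^sup>2" using that by (intro power_mono) auto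
    then have "flat 0 ((z + - a) \<bullet> (z + - a) + - \<delta>\<^sup>2) = 0" unfolding sq by (simp add: flat_def)
    then show ?thesis using pos by (simp add: \<beta>_def q_def)
  qed
  moreover have "\<beta> z = 0" if "z \<notin> cball a \<epsilon>" for z
  proof -
    have "\<epsilon>\<^sup>2 \<le> (dist a z)\<^sup>2" using that assms by (intro power_mono) auto
    then have "T \<le> (z + - a) \<bullet> (z + - a) + - \<delta>\<^sup>2" unfolding sq T_def by simp
    then have "1 \<le> inverse (flat 0 T) * flat 0 ((z + - a) \<bullet> (z + - a) + - \<delta>\<^sup>2)"
      using mono pos by (simp add: field_simps)
    then have "1 + (- inverse (flat 0 T)) *\<^sub>R flat 0 ((z + - a) \<bullet> (z + - a) + - \<delta>\<^sup>2) \<le> 0" by simp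
    then show ?thesis unfolding \<beta>_def q_def by (subst flat_def) simp
  qed
  moreover have "0 < \<delta>" using assms by (simp add: \<delta>_def)
  ultimately show thesis using that[of \<delta> \<beta>] smooth by blast
qed

section \<open>Germs of smooth maps on a manifold\<close>

text \<open>
  Smoothness of the germ at \<open>p\<close> of the map \<open>f\<close> on \<open>A\<close>, read in the chart \<open>(U, \<phi>)\<close>. Asking for a
  smooth representative \<open>F\<close> on a whole neighbourhood \<open>N\<close> in the ambient Euclidean space, with the
  identity \<open>F \<circ> \<phi> = f\<close> tested on the manifold side only, makes change of charts a mere composition of
  representatives. The set \<open>A\<close> is arbitrary, so that the
  restriction of \<open>f\<close> to a submanifold can be read in a chart of \<open>M\<close>.
\<close>

definition smooth_at ::
  "('m, 'b::euclidean_space) manifold \<Rightarrow> 'm set \<Rightarrow> ('m \<Rightarrow> 'b) \<Rightarrow> 'm set \<Rightarrow>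
   ('m \<Rightarrow> 'c::real_normed_vector) \<Rightarrow> 'm \<Rightarrow> bool" where
  "smooth_at M U \<phi> A f p \<longleftrightarrow>
     (\<exists>P N F. openin (mtop M) P \<and> p \<in> P \<and> P \<subseteq> U \<and> open N \<and> \<phi> ` P \<subseteq> N \<and> (\<forall>k. Ck_on k N F) \<and>
        (\<forall>q\<in>A \<inter> P. F (\<phi> q) = f q))"

lemma smooth_atE:
  assumes "smooth_at M U \<phi> A f p"
  obtains P N F where "openin (mtop M) P" "p \<in> P" "P \<subseteq> U" "open N" "\<phi> ` P \<subseteq> N"
    "\<forall>k. Ck_on k N F" "\<forall>q\<in>A \<inter> P. F (\<phi> q) = f q"
  using assms unfolding smooth_at_def by (elim exE conjE) (rule that)

lemma smooth_atI:
  assumes "openin (mtop M) P" "p \<in> P" "P \<subseteq> U" "open N" "\<phi> ` P \<subseteq> N"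
    "\<And>k. Ck_on k N F" "\<And>q. q \<in> A \<Longrightarrow> q \<in> P \<Longrightarrow> F (\<phi> q) = f q"
  shows "smooth_at M U \<phi> A f p"
  unfolding smooth_at_def
  by (rule exI[of _ P], rule exI[of _ N], rule exI[of _ F]) (use assms in simp)

lemma topological_chartD:
  assumes "topological_chart M (U, \<phi>)"
  shows "openin (mtop M) U" "openin (top_of_set (model M)) (\<phi> ` U)" "inj_on \<phi> U"
    "homeomorphic_map (subtopology (mtop M) U) (top_of_set (\<phi> ` U)) \<phi>"
    "topspace (subtopology (mtop M) U) = U"
proof -
  show *: "openin (mtop M) U" "openin (top_of_set (model M)) (\<phi> ` U)"
    "homeomorphic_map (subtopology (mtop M) U) (top_of_set (\<phi> ` U)) \<phi>"
    using assms by (auto simp: topological_chart_def)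
  show **: "topspace (subtopology (mtop M) U) = U"
    using openin_subset[OF *(1)] by auto
  show "inj_on \<phi> U"
    using homeomorphic_imp_injective_map[OF *(3)] ** by simp
qed

lemma chart_preimage_open:
  assumes "topological_chart M (U, \<phi>)" "open N"
  shows "openin (mtop M) {q \<in> U. \<phi> q \<in> N}"
proof -
  note c = topological_chartD[OF assms(1)]
  have "openin (top_of_set (\<phi> ` U)) (\<phi> ` U \<inter> N)" using assms(2) by auto
  then have "openin (subtopology (mtop M) U) {q \<in> U. \<phi> q \<in> \<phi> ` U \<inter> N}"
    using openin_continuous_map_preimage[OF homeomorphic_imp_continuous_map[OF c(4)]]
    unfolding c(5) by blast
  moreover have "{q \<in> U. \<phi> q \<in> \<phi> ` U \<inter> N} = {q \<in> U. \<phi> q \<in> N}" by auto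
  ultimately show ?thesis using c(1) openin_trans_full by metis
qed

lemma chart_image_open:
  assumes "topological_chart M (U, \<phi>)" "openin (mtop M) P" "P \<subseteq> U"
  obtains O' where "open O'" "\<phi> ` P = \<phi> ` U \<inter> O'"
proof -
  note c = topological_chartD[OF assms(1)]
  have "openin (subtopology (mtop M) U) P"
    using assms(2,3) by (auto simp: openin_subtopology)
  then have "openin (top_of_set (\<phi> ` U)) (\<phi> ` P)"
    using homeomorphic_imp_open_map[OF c(4)] by (simp add: open_map_def)
  then show thesis using that by (auto simp: openin_open)
qed

text \<open>
  The chart is a homeomorphism onto its image, so neighbourhoods of \<open>\<phi> p\<close> in \<open>\<phi> ` U\<close> and of \<open>p\<close> in \<open>M\<close>
  correspond to each other.
\<close>

lemma smooth_on_iff_smooth_at: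
  assumes "topological_chart M (U, \<phi>)" "B \<subseteq> U"
  shows "smooth_on (\<phi> ` B) (f \<circ> inv_into U \<phi>) \<longleftrightarrow> (\<forall>p\<in>B. smooth_at M U \<phi> B f p)"
proof -
  note c = topological_chartD[OF assms(1)]
  have inv: "inv_into U \<phi> (\<phi> q) = q" if "q \<in> U" for q using c(3) that by simp
  show ?thesis
  proof (intro iffI ballI)
    fix p assume sm: "smooth_on (\<phi> ` B) (f \<circ> inv_into U \<phi>)" and p: "p \<in> B"
    have "\<exists>N F. open N \<and> \<phi> p \<in> N \<and> (\<forall>k. Ck_on k N F) \<and>
        (\<forall>x\<in>N \<inter> \<phi> ` B. F x = (f \<circ> inv_into U \<phi>) x)"
      using bspec[OF sm[unfolded smooth_on_def] imageI[OF p]] .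
    then obtain N F where N: "open N" "\<phi> p \<in> N" "\<forall>k. Ck_on k N F"
      "\<forall>x\<in>N \<inter> \<phi> ` B. F x = (f \<circ> inv_into U \<phi>) x"
      by (elim exE conjE)
    show "smooth_at M U \<phi> B f p"
    proof (rule smooth_atI)
      show "openin (mtop M) {q \<in> U. \<phi> q \<in> N}" using chart_preimage_open[OF assms(1) N(1)] .
      show "F (\<phi> q) = f q" if "q \<in> B" "q \<in> {q \<in> U. \<phi> q \<in> N}" for q
        using bspec[OF N(4), of "\<phi> q"] that inv by simp
    qed (use N(1,2,3) p assms(2) in auto)
  next
    assume *: "\<forall>p\<in>B. smooth_at M U \<phi> B f p"
    show "smooth_on (\<phi> ` B) (f \<circ> inv_into U \<phi>)"
      unfolding smooth_on_def
    proof
      fix a assume "a \<in> \<phi> ` B"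
      then obtain p where p: "p \<in> B" "a = \<phi> p" by blast
      obtain P N F where F: "openin (mtop M) P" "p \<in> P" "P \<subseteq> U" "open N" "\<phi> ` P \<subseteq> N"
        "\<forall>k. Ck_on k N F" "\<forall>q\<in>B \<inter> P. F (\<phi> q) = f q"
        by (rule smooth_atE[OF bspec[OF * p(1)]])
      obtain O' where O': "open O'" "\<phi> ` P = \<phi> ` U \<inter> O'" using chart_image_open[OF assms(1) F(1,3)] .
      show "\<exists>N F. open N \<and> a \<in> N \<and> (\<forall>k. Ck_on k N F) \<and> (\<forall>x\<in>N \<inter> \<phi> ` B. F x = (f \<circ> inv_into U \<phi>) x)"
      proof (intro exI conjI)
        show "open (N \<inter> O')" using F O' by auto
        have "\<phi> p \<in> \<phi> ` P" using F(2) by (rule imageI)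
        then show "a \<in> N \<inter> O'" using p(2) F(5) O'(2) by blast
        show "\<forall>k. Ck_on k (N \<inter> O') F" using Ck_on_subset[OF F(6)[rule_format]] by blast
        show "\<forall>x\<in>N \<inter> O' \<inter> \<phi> ` B. F x = (f \<circ> inv_into U \<phi>) x"
        proof
          fix x assume "x \<in> N \<inter> O' \<inter> \<phi> ` B"
          then obtain q where q: "q \<in> B" "x = \<phi> q" "\<phi> q \<in> O'" by blast
          then have "\<phi> q \<in> \<phi> ` P" using O' assms(2) by auto
          then obtain q' where "q' \<in> P" "\<phi> q = \<phi> q'" by blast
          then have "q \<in> P" using inj_onD[OF c(3), of q q'] q(1) assms(2) F(3) by blast
          then have "F (\<phi> q) = f q" using F(7) q(1) by blast
          moreover have "inv_into U \<phi> (\<phi> q) = q" using inv q(1) assms(2) by blast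
          ultimately show "F x = (f \<circ> inv_into U \<phi>) x" using q(2) by simp
        qed
      qed
    qed
  qed
qed

text \<open>
  If \<open>F\<close> represents \<open>f\<close> in the chart \<open>\<eta>\<close> and \<open>G\<close> represents \<open>\<eta>\<close> in the chart \<open>\<phi>\<close>, then \<open>F \<circ> G\<close>
  represents \<open>f\<close> in the chart \<open>\<phi>\<close>.
\<close>

lemma smooth_at_change_chart:
  assumes U: "topological_chart M (U, \<phi>)" and V: "topological_chart M (V, \<eta>)"
    and tr: "smooth_transition (U, \<phi>) (V, \<eta>)"
    and p: "p \<in> U" "p \<in> V" and f: "smooth_at M V \<eta> A f p"
  shows "smooth_at M U \<phi> A f p"
proof -
  obtain P N F where F: "openin (mtop M) P" "p \<in> P" "P \<subseteq> V" "open N" "\<eta> ` P \<subseteq> N"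
    "\<forall>k. Ck_on k N F" "\<forall>q\<in>A \<inter> P. F (\<eta> q) = f q"
    by (rule smooth_atE[OF f])
  have "smooth_at M U \<phi> (U \<inter> V) \<eta> p"
    using tr p smooth_on_iff_smooth_at[OF U, of "U \<inter> V" \<eta>] by (simp add: smooth_transition_def)
  then obtain P' N' G where G: "openin (mtop M) P'" "p \<in> P'" "P' \<subseteq> U" "open N'" "\<phi> ` P' \<subseteq> N'"
    "\<forall>k. Ck_on k N' G" "\<forall>q\<in>U \<inter> V \<inter> P'. G (\<phi> q) = \<eta> q"
    by (rule smooth_atE)
  let ?N = "N' \<inter> G -` N"
  have "continuous_on N' G" using G(6) Ck_on.simps(1) by blast
  then have oN: "open ?N"
    using continuous_open_preimage[OF _ G(4) F(4)] by blast
  show ?thesis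
  proof (rule smooth_atI)
    show "openin (mtop M) (P \<inter> P')" using F(1) G(1) by blast
    show "open ?N" by (rule oN)
    have GF: "G (\<phi> q) = \<eta> q" if "q \<in> P \<inter> P'" for q using F(3) G(3,7) that by blast
    show "\<phi> ` (P \<inter> P') \<subseteq> ?N"
    proof
      fix z assume "z \<in> \<phi> ` (P \<inter> P')"
      then obtain q where q: "q \<in> P \<inter> P'" "z = \<phi> q" by blast
      then have "z \<in> N'" using G(5) by blast
      moreover have "G z \<in> N" unfolding q(2) GF[OF q(1)] using q(1) F(5) by blast
      ultimately show "z \<in> ?N" by blast
    qed
    have "Ck_on k ?N G" for k using Ck_on_subset[OF G(6)[rule_format], of ?N] by blast
    then show "Ck_on k ?N (\<lambda>x. F (G x))" for k
      using Ck_on_compose[OF oN F(4) _ _ F(6)[rule_format]] by blast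
    show "F (G (\<phi> q)) = f q" if "q \<in> A" "q \<in> P \<inter> P'" for q
      using GF[OF that(2)] bspec[OF F(7), of q] that by simp
  qed (use F(2,3) G(2,3) in auto)
qed

definition smooth_germ ::
  "('m, 'b::euclidean_space) manifold \<Rightarrow> 'm set \<Rightarrow> ('m \<Rightarrow> 'c::real_normed_vector) \<Rightarrow> 'm \<Rightarrow> bool" where
  "smooth_germ M A f p \<longleftrightarrow> (\<exists>U \<phi>. (U, \<phi>) \<in> atlas M \<and> p \<in> U \<and> smooth_at M U \<phi> A f p)"

lemma atlas_chart:
  assumes "smooth_manifold M" "c \<in> atlas M"
  shows "topological_chart M c" "smooth_chart M c"
  using assms by (auto simp: smooth_manifold_def smooth_chart_def)

lemma atlas_covers:
  assumes "smooth_manifold M" "p \<in> carrier M"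
  obtains U \<phi> where "(U, \<phi>) \<in> atlas M" "p \<in> U"
proof -
  have "p \<in> (\<Union>(U, \<phi>)\<in>atlas M. U)" using assms by (simp add: smooth_manifold_def)
  then show thesis using that by auto
qed

text \<open>
  Independence of the chart, including charts of the maximal atlas; the latter are needed for the
  slice charts of a submanifold.
\<close>

lemma smooth_germ_in_chart:
  assumes "smooth_manifold M" "smooth_germ M A f p" "smooth_chart M (U, \<phi>)" "p \<in> U"
  shows "smooth_at M U \<phi> A f p"
proof -
  obtain V \<eta> where V: "(V, \<eta>) \<in> atlas M" "p \<in> V" "smooth_at M V \<eta> A f p"
    using assms(2) unfolding smooth_germ_def by blast
  have "topological_chart M (U, \<phi>)" "smooth_transition (U, \<phi>) (V, \<eta>)"
    using assms(3) V(1) by (simp_all add: smooth_chart_def)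
  then show ?thesis
    by (rule smooth_at_change_chart[OF _ atlas_chart(1)[OF assms(1) V(1)] _ assms(4) V(2,3)])
qed

lemma smooth_at_cong:
  assumes "smooth_at M U \<phi> A f p" "openin (mtop M) P" "p \<in> P"
    and "\<And>q. q \<in> B \<inter> P \<Longrightarrow> q \<in> A \<and> f' q = f q"
  shows "smooth_at M U \<phi> B f' p"
proof -
  obtain Q N F where F: "openin (mtop M) Q" "p \<in> Q" "Q \<subseteq> U" "open N" "\<phi> ` Q \<subseteq> N"
    "\<forall>k. Ck_on k N F" "\<forall>q\<in>A \<inter> Q. F (\<phi> q) = f q"
    by (rule smooth_atE[OF assms(1)])
  show ?thesis
  proof (rule smooth_atI[of M "Q \<inter> P" p U N \<phi> F])
    show "F (\<phi> q) = f' q" if "q \<in> B" "q \<in> Q \<inter> P" for q using F(7) assms(4) that by simp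
  qed (use F(1-6) assms(2,3) in auto)
qed

lemma smooth_germ_cong:
  assumes "smooth_germ M A f p" "openin (mtop M) P" "p \<in> P"
    and "\<And>q. q \<in> B \<inter> P \<Longrightarrow> q \<in> A \<and> f' q = f q"
  shows "smooth_germ M B f' p"
proof -
  obtain U \<phi> where c: "(U, \<phi>) \<in> atlas M" "p \<in> U" "smooth_at M U \<phi> A f p"
    using assms(1) unfolding smooth_germ_def by blast
  have "smooth_at M U \<phi> B f' p" by (rule smooth_at_cong[OF c(3) assms(2-4)])
  then show ?thesis using c unfolding smooth_germ_def by blast
qed

lemma smooth_map_on_iff_germ:
  assumes "smooth_manifold M" "A \<subseteq> carrier M"
  shows "smooth_map_on M A f \<longleftrightarrow> (\<forall>p\<in>A. smooth_germ M A f p)"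
proof (intro iffI ballI)
  fix p assume f: "smooth_map_on M A f" and p: "p \<in> A"
  obtain U \<phi> where c: "(U, \<phi>) \<in> atlas M" "p \<in> U" using atlas_covers[OF assms(1)] assms(2) p by blast
  note U = atlas_chart(1)[OF assms(1) c(1)]
  have "smooth_at M U \<phi> (A \<inter> U) f p"
  proof -
    have "smooth_on (\<phi> ` (A \<inter> U)) (f \<circ> inv_into U \<phi>)"
      using f c(1) unfolding smooth_map_on_def by blast
    then show ?thesis
      using smooth_on_iff_smooth_at[OF U, of "A \<inter> U" f] p c(2) by blast
  qed
  then have "smooth_at M U \<phi> A f p"
    by (rule smooth_at_cong[OF _ topological_chartD(1)[OF U] c(2)]) auto
  then show "smooth_germ M A f p" using c unfolding smooth_germ_def by blast
next
  assume f: "\<forall>p\<in>A. smooth_germ M A f p"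
  have "smooth_on (\<phi> ` (A \<inter> U)) (f \<circ> inv_into U \<phi>)" if "(U, \<phi>) \<in> atlas M" for U \<phi>
  proof -
    note U = atlas_chart[OF assms(1) that]
    have "smooth_at M U \<phi> (A \<inter> U) f p" if p: "p \<in> A \<inter> U" for p
    proof -
      have "smooth_germ M A f p" using f p by blast
      then have "smooth_at M U \<phi> A f p" using smooth_germ_in_chart[OF assms(1) _ U(2)] p by blast
      then show ?thesis
        by (rule smooth_at_cong[OF _ topological_chartD(1)[OF U(1)]]) (use p in auto)
    qed
    then show ?thesis using smooth_on_iff_smooth_at[OF U(1), of "A \<inter> U"] by blast
  qed
  then show "smooth_map_on M A f" by (auto simp: smooth_map_on_def)
qed

lemma smooth_germ_const:
  assumes "smooth_manifold M" "p \<in> carrier M"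
  shows "smooth_germ M A (\<lambda>_. c) p"
proof -
  obtain U \<phi> where c: "(U, \<phi>) \<in> atlas M" "p \<in> U" by (rule atlas_covers[OF assms])
  have "smooth_at M U \<phi> A (\<lambda>_. c) p"
    by (rule smooth_atI[of M U p U UNIV \<phi> "\<lambda>_. c"])
      (use c topological_chartD(1)[OF atlas_chart(1)[OF assms(1) c(1)]] Ck_on_const[OF open_UNIV] in simp_all)
  then show ?thesis using c unfolding smooth_germ_def by blast
qed

lemma smooth_germ_binary:
  assumes M: "smooth_manifold M" and f: "smooth_germ M A f p" and h: "smooth_germ M A h p"
    and op: "\<And>k N F G. open N \<Longrightarrow> Ck_on k N F \<Longrightarrow> Ck_on k N G \<Longrightarrow> Ck_on k N (\<lambda>z::'b. op (F z) (G z))"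
  shows "smooth_germ (M :: ('m, 'b::euclidean_space) manifold) A (\<lambda>q. op (f q) (h q)) p"
proof -
  obtain U \<phi> where c: "(U, \<phi>) \<in> atlas M" "p \<in> U" "smooth_at M U \<phi> A f p"
    using f unfolding smooth_germ_def by blast
  have "smooth_at M U \<phi> A h p"
    using smooth_germ_in_chart[OF M h atlas_chart(2)[OF M c(1)] c(2)] .
  then obtain Q N G where G: "openin (mtop M) Q" "p \<in> Q" "Q \<subseteq> U" "open N" "\<phi> ` Q \<subseteq> N"
    "\<forall>k. Ck_on k N G" "\<forall>q\<in>A \<inter> Q. G (\<phi> q) = h q"
    by (rule smooth_atE)
  obtain P N' F where F: "openin (mtop M) P" "p \<in> P" "P \<subseteq> U" "open N'" "\<phi> ` P \<subseteq> N'"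
    "\<forall>k. Ck_on k N' F" "\<forall>q\<in>A \<inter> P. F (\<phi> q) = f q"
    by (rule smooth_atE[OF c(3)])
  have opk: "Ck_on k (N \<inter> N') (\<lambda>z. op (F z) (G z))" for k
    by (rule op[OF open_Int[OF G(4) F(4)] Ck_on_subset[OF F(6)[rule_format]] Ck_on_subset[OF G(6)[rule_format]]]) auto
  have "smooth_at M U \<phi> A (\<lambda>q. op (f q) (h q)) p"
    by (rule smooth_atI[of M "P \<inter> Q" p U "N \<inter> N'" \<phi> "\<lambda>z. op (F z) (G z)"])
      (use F(1-5,7) G(1-5,7) opk in \<open>simp_all, blast+\<close>)
  then show ?thesis using c unfolding smooth_germ_def by blast
qed

lemmas smooth_germ_add = smooth_germ_binary[where op = "(+)", OF _ _ _ Ck_on_add]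
lemmas smooth_germ_scaleR =
  smooth_germ_binary[where op = "(*\<^sub>R)", OF _ _ _ bounded_bilinear.Ck_on_image2[OF bounded_bilinear_scaleR]]

lemma openin_carrier: "openin (mtop M) (carrier M)"
  by (simp add: carrier_def)

lemma smooth_functions_iff_germ:
  assumes "smooth_manifold M"
  shows "f \<in> smooth_functions M \<longleftrightarrow>
    (\<forall>p\<in>carrier M. smooth_germ M (carrier M) f p) \<and> (\<forall>x. x \<notin> carrier M \<longrightarrow> f x = 0)"
  by (simp add: smooth_functions_def smooth_map_on_iff_germ[OF assms])

lemma smooth_functions_mult:
  assumes "smooth_manifold M" "f \<in> smooth_functions M" "h \<in> smooth_functions M"
  shows "(\<lambda>x. f x * h x) \<in> smooth_functions M"
proof -
  note iff = smooth_functions_iff_germ[OF assms(1)]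
  have "smooth_germ M (carrier M) (\<lambda>x. f x *\<^sub>R h x) p" if "p \<in> carrier M" for p
    using assms(2,3) that unfolding iff by (intro smooth_germ_scaleR[OF assms(1)]) blast+
  then show ?thesis using assms(2) unfolding iff real_scaleR_def by simp
qed

lemma smooth_functions_add:
  assumes "smooth_manifold M" "f \<in> smooth_functions M" "h \<in> smooth_functions M"
  shows "(\<lambda>x. f x + h x) \<in> smooth_functions M"
proof -
  note iff = smooth_functions_iff_germ[OF assms(1)]
  have "smooth_germ M (carrier M) (\<lambda>x. f x + h x) p" if "p \<in> carrier M" for p
    using assms(2,3) that unfolding iff by (intro smooth_germ_add[OF assms(1)]) blast+
  then show ?thesis using assms(2,3) unfolding iff by simp
qed

text \<open>
  A Euclidean bump transported by a chart. Its support is compact, hence closed because the manifold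
  is Hausdorff, and that is what makes the extension by \<open>0\<close> smooth.
\<close>

lemma smooth_function_bump:
  assumes M: "smooth_manifold M" and W: "openin (mtop M) W" "x \<in> W"
  obtains h K N where "h \<in> smooth_functions M" "closedin (mtop M) K" "K \<subseteq> W"
    "openin (mtop M) N" "x \<in> N" "N \<subseteq> W" "\<forall>y\<in>N. h y = 1" "\<forall>y. y \<notin> K \<longrightarrow> h y = 0"
proof -
  have xM: "x \<in> carrier M" using W openin_subset by (auto simp: carrier_def)
  obtain U \<phi> where c: "(U, \<phi>) \<in> atlas M" "x \<in> U" by (rule atlas_covers[OF M xM])
  note tc = atlas_chart(1)[OF M c(1)] and U = topological_chartD[OF atlas_chart(1)[OF M c(1)]]
  obtain O1 where O1: "open O1" "\<phi> ` (W \<inter> U) = \<phi> ` U \<inter> O1"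
    using chart_image_open[OF tc, of "W \<inter> U"] W U(1) by blast
  obtain O2 where O2: "open O2" "\<phi> ` U = model M \<inter> O2" using U(2) by (auto simp: openin_open)
  have "open (O1 \<inter> O2)" "\<phi> x \<in> O1 \<inter> O2" using O1 O2 c W by auto
  then obtain \<epsilon> where e: "0 < \<epsilon>" "cball (\<phi> x) \<epsilon> \<subseteq> O1 \<inter> O2" by (meson open_contains_cball)
  obtain \<beta> :: "'b \<Rightarrow> real" and \<delta> where b: "0 < \<delta>" "\<forall>k. Ck_on k UNIV \<beta>"
    "\<forall>z\<in>ball (\<phi> x) \<delta>. \<beta> z = 1" "\<forall>z. z \<notin> cball (\<phi> x) \<epsilon> \<longrightarrow> \<beta> z = 0"
    by (rule bump_function[OF e(1)])
  define h where "h y = (if y \<in> U then \<beta> (\<phi> y) else 0)" for y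
  define K where "K = {y \<in> U. \<phi> y \<in> cball (\<phi> x) \<epsilon>}"
  have "\<phi> ` K = \<phi> ` U \<inter> cball (\<phi> x) \<epsilon>" unfolding K_def by blast
  also have "\<dots> = model M \<inter> cball (\<phi> x) \<epsilon>" unfolding O2(2) using e(2) by blast
  finally have "\<phi> ` K = model M \<inter> cball (\<phi> x) \<epsilon>" .
  moreover have "compact (model M \<inter> cball (\<phi> x) \<epsilon>)"
    using M by (intro closed_Int_compact closed_subspace compact_cball) (simp add: smooth_manifold_def)
  moreover have KU: "K \<subseteq> U" unfolding K_def by blast
  ultimately have "compactin (top_of_set (\<phi> ` U)) (\<phi> ` K)"
    unfolding compactin_subtopology compactin_euclidean_iff using image_mono by metis
  then have "compactin (subtopology (mtop M) U) K"
    using homeomorphic_map_compactness_eq[OF U(4), of K] KU unfolding U(5) by blast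
  then have "compactin (mtop M) K" unfolding compactin_subtopology by blast
  then have Kc: "closedin (mtop M) K"
    using M by (intro compactin_imp_closedin) (simp_all add: smooth_manifold_def)
  have KW: "K \<subseteq> W"
  proof
    fix y assume y: "y \<in> K"
    then have "\<phi> y \<in> \<phi> ` (W \<inter> U)" unfolding O1(2) using e(2) by (auto simp: K_def)
    then obtain w where "w \<in> W \<inter> U" "\<phi> y = \<phi> w" by blast
    then show "y \<in> W" using y KU inj_onD[OF U(3), of y w] by blast
  qed
  have h0: "h y = 0" if "y \<notin> K" for y using that b(4) by (auto simp: h_def K_def)
  have "smooth_germ M (carrier M) h p" if p: "p \<in> carrier M" for p
  proof (cases "p \<in> U")
    case True
    have "smooth_at M U \<phi> (carrier M) h p"
      by (rule smooth_atI[of M U p U UNIV \<phi> \<beta>]) (use True U(1) b(2) in \<open>auto simp: h_def\<close>)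
    then show ?thesis using c True unfolding smooth_germ_def by blast
  next
    case False
    show ?thesis
    proof (rule smooth_germ_cong[OF smooth_germ_const[OF M p, of "carrier M" 0]])
      show "openin (mtop M) (carrier M - K)" using Kc by (simp add: carrier_def closedin_def)
    qed (use False p h0 in \<open>auto simp: K_def\<close>)
  qed
  moreover have "U \<subseteq> carrier M" using openin_subset[OF U(1)] by (simp add: carrier_def)
  ultimately have "h \<in> smooth_functions M"
    unfolding smooth_functions_iff_germ[OF M] by (auto simp: h_def)
  moreover have "openin (mtop M) ({q \<in> U. \<phi> q \<in> ball (\<phi> x) \<delta>} \<inter> W)"
    using chart_preimage_open[OF tc, of "ball (\<phi> x) \<delta>"] W by blast
  ultimately show thesis
    by (rule that[OF _ Kc KW]) (use c b W h0 in \<open>auto simp: h_def\<close>)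
qed

text \<open>
  In a slice chart \<open>\<phi>\<close> of \<open>M\<close>, the representative of \<open>f\<close> also represents its restriction, because
  the chart of \<open>S\<close> is a restriction of \<open>\<phi>\<close>.
\<close>

lemma smooth_map_on_submanifold:
  assumes M: "smooth_manifold M" and S: "submanifold M S" and A: "A \<subseteq> carrier M"
    and f: "smooth_map_on M A f" and B: "B \<subseteq> A" and f': "\<And>q. q \<in> B \<Longrightarrow> f' q = f q"
  shows "smooth_map_on S B f'"
proof -
  have "smooth_on (\<phi> ` (B \<inter> V)) (f' \<circ> inv_into V \<phi>)" if chart: "(V, \<phi>) \<in> atlas S" for V \<phi>
  proof -
    obtain U where U: "smooth_chart M (U, \<phi>)" "V = U \<inter> carrier S"
    proof -
      have "\<forall>(V, \<phi>)\<in>atlas S. \<exists>U. smooth_chart M (U, \<phi>) \<and> V = U \<inter> carrier S \<and> \<phi> ` V = \<phi> ` U \<inter> model S"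
        using S by (simp add: submanifold_def)
      from bspec[OF this chart] show thesis using that by auto
    qed
    then have tc: "topological_chart M (U, \<phi>)" by (simp add: smooth_chart_def)
    note inj = topological_chartD(3)[OF tc]
    have at: "smooth_at M U \<phi> (B \<inter> V) f' p" if p: "p \<in> B \<inter> V" for p
    proof -
      have "smooth_germ M A f p" using f p B smooth_map_on_iff_germ[OF M A] by blast
      then have "smooth_at M U \<phi> A f p"
        by (rule smooth_germ_in_chart[OF M _ U(1)]) (use p U(2) in blast)
      then show ?thesis
        by (rule smooth_at_cong[OF _ topological_chartD(1)[OF tc]]) (use p U(2) B f' in auto)
    qed
    then have "smooth_on (\<phi> ` (B \<inter> V)) (f' \<circ> inv_into U \<phi>)"
      using iffD2[OF smooth_on_iff_smooth_at[OF tc, of "B \<inter> V" f']] at U(2) by blast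
    moreover have "(f' \<circ> inv_into U \<phi>) z = (f' \<circ> inv_into V \<phi>) z" if "z \<in> \<phi> ` (B \<inter> V)" for z
    proof -
      obtain q where q: "q \<in> V" "z = \<phi> q" using \<open>z \<in> \<phi> ` (B \<inter> V)\<close> by blast
      moreover have "inj_on \<phi> V" using inj U(2) inj_on_subset by blast
      ultimately show ?thesis using inj U(2) by simp
    qed
    ultimately show ?thesis unfolding smooth_on_def by fastforce
  qed
  then show ?thesis by (auto simp: smooth_map_on_def)
qed

section \<open>Sections of a vector bundle\<close>

lemma linear_map_onD:
  assumes "linear_map_on F f" "x \<in> F"
  shows "y \<in> F \<Longrightarrow> f (x + y) = f x + f y" "f (c *\<^sub>R x) = c *\<^sub>R f x" "f 0 = 0"
proof -
  show "y \<in> F \<Longrightarrow> f (x + y) = f x + f y" using assms by (simp add: linear_map_on_def)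
  show *: "f (c *\<^sub>R x) = c *\<^sub>R f x" for c using assms by (simp add: linear_map_on_def)
  show "f 0 = 0" using *[of 0] by simp
qed

locale smooth_bundle =
  fixes M :: "('m, 'b::euclidean_space) manifold"
    and E :: "('m, 'v::real_vector, 'f::euclidean_space) vbundle"
  assumes manifold: "smooth_manifold M" and vb: "vector_bundle M E"
begin

abbreviation \<Gamma> where "\<Gamma> \<equiv> sections M E (carrier M)"

lemma fibre_subspace: "x \<in> carrier M \<Longrightarrow> subspace (fibre E x)"
  using vb by (simp add: vector_bundle_def)

lemma open_subset_carrier: "openin (mtop M) U \<Longrightarrow> U \<subseteq> carrier M"
  using openin_subset by (simp add: carrier_def)

lemma trivialisation:
  assumes "(V, \<Phi>) \<in> trivs E"
  shows "openin (mtop M) V" "V \<subseteq> carrier M"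
    "x \<in> V \<Longrightarrow> linear_map_on (fibre E x) (\<Phi> x)"
    "x \<in> V \<Longrightarrow> bij_betw (\<Phi> x) (fibre E x) (typical_fibre E)"
proof -
  have "\<forall>(U, \<Phi>)\<in>trivs E. openin (mtop M) U \<and>
        (\<forall>x\<in>U. linear_map_on (fibre E x) (\<Phi> x) \<and>
                bij_betw (\<Phi> x) (fibre E x) (typical_fibre E))"
    using vb by (simp add: vector_bundle_def)
  from bspec[OF this assms] show *: "openin (mtop M) V"
    "x \<in> V \<Longrightarrow> linear_map_on (fibre E x) (\<Phi> x)"
    "x \<in> V \<Longrightarrow> bij_betw (\<Phi> x) (fibre E x) (typical_fibre E)" by auto
  show "V \<subseteq> carrier M" by (rule open_subset_carrier[OF *(1)])
qed

lemma sectionI: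
  assumes "U \<subseteq> carrier M" "\<And>x. x \<in> U \<Longrightarrow> \<psi> x \<in> fibre E x" "\<And>x. x \<notin> U \<Longrightarrow> \<psi> x = 0"
    and "\<And>V \<Phi> p. (V, \<Phi>) \<in> trivs E \<Longrightarrow> p \<in> U \<Longrightarrow> p \<in> V \<Longrightarrow> smooth_germ M (U \<inter> V) (\<lambda>x. \<Phi> x (\<psi> x)) p"
  shows "\<psi> \<in> sections M E U"
proof -
  have "smooth_map_on M (U \<inter> V) (\<lambda>x. \<Phi> x (\<psi> x))" if "(V, \<Phi>) \<in> trivs E" for V \<Phi>
  proof (rule iffD2[OF smooth_map_on_iff_germ[OF manifold]])
    show "U \<inter> V \<subseteq> carrier M" using assms(1) by blast
  qed (use assms(4)[OF that] in blast)
  then show ?thesis using assms(2,3) by (auto simp: sections_def)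
qed

lemma section_in_fibre: "\<psi> \<in> sections M E U \<Longrightarrow> x \<in> U \<Longrightarrow> \<psi> x \<in> fibre E x"
  by (simp add: sections_def)

lemma section_outside: "\<psi> \<in> sections M E U \<Longrightarrow> x \<notin> U \<Longrightarrow> \<psi> x = 0"
  by (simp add: sections_def)

lemma section_germ:
  assumes "\<psi> \<in> sections M E U" "U \<subseteq> carrier M" "(V, \<Phi>) \<in> trivs E" "p \<in> U" "p \<in> V"
  shows "smooth_germ M (U \<inter> V) (\<lambda>x. \<Phi> x (\<psi> x)) p"
proof -
  have "\<forall>(V, \<Phi>)\<in>trivs E. smooth_map_on M (U \<inter> V) (\<lambda>x. \<Phi> x (\<psi> x))"
    using assms(1) by (simp add: sections_def)
  from bspec[OF this assms(3)] have sm: "smooth_map_on M (U \<inter> V) (\<lambda>x. \<Phi> x (\<psi> x))" by simp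
  have sub: "U \<inter> V \<subseteq> carrier M" using assms(2) by blast
  have "\<forall>p\<in>U \<inter> V. smooth_germ M (U \<inter> V) (\<lambda>x. \<Phi> x (\<psi> x)) p"
    by (rule iffD1[OF smooth_map_on_iff_germ[OF manifold sub] sm])
  then show ?thesis using assms(4,5) by simp
qed

lemma section_lincomb:
  assumes "\<psi> \<in> \<Gamma>" "\<psi>' \<in> \<Gamma>"
  shows "(\<lambda>x. a *\<^sub>R \<psi> x + b *\<^sub>R \<psi>' x) \<in> \<Gamma>"
proof (rule sectionI)
  fix x assume "x \<in> carrier M"
  then show "a *\<^sub>R \<psi> x + b *\<^sub>R \<psi>' x \<in> fibre E x"
    using assms fibre_subspace section_in_fibre by (intro subspace_add subspace_scale) auto
next
  fix V \<Phi> p assume V: "(V, \<Phi>) \<in> trivs E" and p: "p \<in> carrier M" "p \<in> V"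
  note germ = section_germ[OF _ order_refl V p]
  have germ2: "smooth_germ M (carrier M \<inter> V) (\<lambda>x. a *\<^sub>R \<Phi> x (\<psi> x) + b *\<^sub>R \<Phi> x (\<psi>' x)) p"
    by (intro smooth_germ_add[OF manifold] smooth_germ_scaleR[OF manifold]
        germ[OF assms(1)] germ[OF assms(2)] smooth_germ_const[OF manifold p(1)])
  show "smooth_germ M (carrier M \<inter> V) (\<lambda>x. \<Phi> x (a *\<^sub>R \<psi> x + b *\<^sub>R \<psi>' x)) p"
  proof (rule smooth_germ_cong[OF germ2 openin_carrier p(1)])
    fix q assume q: "q \<in> carrier M \<inter> V \<inter> carrier M"
    then have lin: "linear_map_on (fibre E q) (\<Phi> q)" using trivialisation(3)[OF V] by blast
    have fib: "\<psi> q \<in> fibre E q" "\<psi>' q \<in> fibre E q" "subspace (fibre E q)"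
      using q assms section_in_fibre fibre_subspace by auto
    then have "a *\<^sub>R \<psi> q \<in> fibre E q" "b *\<^sub>R \<psi>' q \<in> fibre E q" by (simp_all add: subspace_scale)
    then show "q \<in> carrier M \<inter> V \<and>
        \<Phi> q (a *\<^sub>R \<psi> q + b *\<^sub>R \<psi>' q) = a *\<^sub>R \<Phi> q (\<psi> q) + b *\<^sub>R \<Phi> q (\<psi>' q)"
      using q fib linear_map_onD(1,2)[OF lin] by simp
  qed
qed (use section_outside[OF assms(1)] section_outside[OF assms(2)] in auto)

text \<open>
  A local section times a function whose support is closed in \<open>M\<close> and contained in the domain of the
  section: smooth on the domain as a product, and smooth elsewhere because it vanishes near there.
\<close>

lemma section_extend_by_cutoff:
  assumes \<psi>: "\<psi> \<in> sections M E U" and U: "openin (mtop M) U"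
    and h: "h \<in> smooth_functions M" and K: "closedin (mtop M) K" "K \<subseteq> U" "\<forall>x. x \<notin> K \<longrightarrow> h x = 0"
  shows "(\<lambda>x. h x *\<^sub>R \<psi> x) \<in> \<Gamma>"
proof (rule sectionI)
  fix x assume x: "x \<in> carrier M"
  show "h x *\<^sub>R \<psi> x \<in> fibre E x"
  proof (cases "x \<in> U")
    case True
    then show ?thesis
      using section_in_fibre[OF \<psi>] subspace_scale[OF fibre_subspace[OF x]] by simp
  next
    case False
    then show ?thesis using section_outside[OF \<psi>] subspace_0[OF fibre_subspace[OF x]] by simp
  qed
next
  fix x assume "x \<notin> carrier M"
  then have "x \<notin> U" using open_subset_carrier[OF U] by blast
  then show "h x *\<^sub>R \<psi> x = 0" using section_outside[OF \<psi>] by simp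
next
  fix V \<Phi> p assume V: "(V, \<Phi>) \<in> trivs E" and p: "p \<in> carrier M" "p \<in> V"
  have scale: "\<Phi> q (h q *\<^sub>R e) = h q *\<^sub>R \<Phi> q e" if "q \<in> V" "e \<in> fibre E q" for q e
    using linear_map_onD(2)[OF trivialisation(3)[OF V that(1)] that(2)] .
  have zero: "\<Phi> q 0 = 0" if "q \<in> V" for q
  proof -
    have "q \<in> carrier M" using that trivialisation(2)[OF V] by blast
    then show ?thesis
      using linear_map_onD(3)[OF trivialisation(3)[OF V that] subspace_0[OF fibre_subspace]] by blast
  qed
  show "smooth_germ M (carrier M \<inter> V) (\<lambda>x. \<Phi> x (h x *\<^sub>R \<psi> x)) p"
  proof (cases "p \<in> U")
    case True
    have "smooth_germ M (carrier M) h p"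
      using h p(1) smooth_functions_iff_germ[OF manifold] by blast
    then have "smooth_germ M (U \<inter> V) h p"
      by (rule smooth_germ_cong[OF _ openin_carrier p(1)]) auto
    then have germ: "smooth_germ M (U \<inter> V) (\<lambda>x. h x *\<^sub>R \<Phi> x (\<psi> x)) p"
      by (rule smooth_germ_scaleR[OF manifold _ section_germ[OF \<psi> open_subset_carrier[OF U] V True p(2)]])
    show ?thesis
      by (rule smooth_germ_cong[OF germ U True]) (use scale section_in_fibre[OF \<psi>] in auto)
  next
    case False
    have "openin (mtop M) (carrier M - K)" using K(1) by (simp add: carrier_def closedin_def)
    moreover have "p \<in> carrier M - K" using p(1) False K(2) by blast
    ultimately show ?thesis
      by (rule smooth_germ_cong[OF smooth_germ_const[OF manifold p(1), of "carrier M" 0]])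
        (use K(3) zero in auto)
  qed
qed simp

lemma section_scale:
  assumes "f \<in> smooth_functions M" "\<psi> \<in> \<Gamma>"
  shows "(\<lambda>x. f x *\<^sub>R \<psi> x) \<in> \<Gamma>"
proof (rule section_extend_by_cutoff[OF assms(2) openin_carrier assms(1)])
  show "closedin (mtop M) (carrier M)" by (simp add: carrier_def)
  show "\<forall>x. x \<notin> carrier M \<longrightarrow> f x = 0" using assms(1) by (simp add: smooth_functions_def)
qed simp

lemma constant_section:
  assumes V: "(V, \<Phi>) \<in> trivs E" and w: "w \<in> typical_fibre E"
  shows "restr V (\<lambda>x. inv_into (fibre E x) (\<Phi> x) w) \<in> sections M E V"
proof -
  have VM: "V \<subseteq> carrier M" by (rule trivialisation(2)[OF V])
  have "\<forall>(U, \<Phi>)\<in>trivs E. \<forall>(V, \<Psi>)\<in>trivs E. \<forall>w\<in>typical_fibre E.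
        smooth_map_on M (U \<inter> V) (\<lambda>x. \<Psi> x (inv_into (fibre E x) (\<Phi> x) w))"
    using vb by (simp add: vector_bundle_def)
  from bspec[OF this V] have "\<forall>(W, \<Psi>)\<in>trivs E. \<forall>w\<in>typical_fibre E.
        smooth_map_on M (V \<inter> W) (\<lambda>x. \<Psi> x (inv_into (fibre E x) (\<Phi> x) w))" by simp
  note triv = this
  have sm: "smooth_map_on M (V \<inter> W) (\<lambda>x. \<Psi> x (inv_into (fibre E x) (\<Phi> x) w))"
    if "(W, \<Psi>) \<in> trivs E" for W \<Psi>
    using bspec[OF triv that] w by simp
  show ?thesis
  proof (rule sectionI[OF VM])
    fix x assume x: "x \<in> V"
    have "w \<in> \<Phi> x ` fibre E x" using trivialisation(4)[OF V x] w by (simp add: bij_betw_def)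
    then show "restr V (\<lambda>x. inv_into (fibre E x) (\<Phi> x) w) x \<in> fibre E x"
      using x by (simp add: restr_def inv_into_into)
  next
    fix W \<Psi> p assume W: "(W, \<Psi>) \<in> trivs E" and p: "p \<in> V" "p \<in> W"
    have VW: "V \<inter> W \<subseteq> carrier M" using VM by blast
    have "smooth_germ M (V \<inter> W) (\<lambda>x. \<Psi> x (inv_into (fibre E x) (\<Phi> x) w)) p"
      using iffD1[OF smooth_map_on_iff_germ[OF manifold VW] sm[OF W]] p by simp
    then show "smooth_germ M (V \<inter> W) (\<lambda>x. \<Psi> x (restr V (\<lambda>x. inv_into (fibre E x) (\<Phi> x) w) x)) p"
      by (rule smooth_germ_cong[OF _ trivialisation(1)[OF V] p(1)]) (simp add: restr_def)
  qed (simp add: restr_def)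
qed

lemma section_through_point:
  assumes x: "x \<in> carrier M" and e0: "e0 \<in> fibre E x"
  obtains e where "e \<in> \<Gamma>" "e x = e0"
proof -
  have "x \<in> (\<Union>(U, \<Phi>)\<in>trivs E. U)" using vb x by (simp add: vector_bundle_def)
  then obtain V \<Phi> where V: "(V, \<Phi>) \<in> trivs E" "x \<in> V" by auto
  note bij = trivialisation(4)[OF V]
  let ?c = "restr V (\<lambda>y. inv_into (fibre E y) (\<Phi> y) (\<Phi> x e0))"
  have "\<Phi> x e0 \<in> typical_fibre E" using bij e0 by (auto simp: bij_betw_def)
  then have c: "?c \<in> sections M E V" by (rule constant_section[OF V(1)])
  have cx: "?c x = e0" using bij e0 V(2) by (simp add: restr_def bij_betw_def)
  obtain h K N where h: "h \<in> smooth_functions M" "closedin (mtop M) K" "K \<subseteq> V"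
    "openin (mtop M) N" "x \<in> N" "N \<subseteq> V" "\<forall>y\<in>N. h y = 1" "\<forall>y. y \<notin> K \<longrightarrow> h y = 0"
    by (rule smooth_function_bump[OF manifold trivialisation(1)[OF V(1)] V(2)])
  show thesis
  proof (rule that)
    show "(\<lambda>y. h y *\<^sub>R ?c y) \<in> \<Gamma>"
      by (rule section_extend_by_cutoff[OF c trivialisation(1)[OF V(1)] h(1,2,3,8)])
    show "h x *\<^sub>R ?c x = e0" using h(5,7) cx by simp
  qed
qed

end

section \<open>Tangent vectors\<close>

lemma tangent_space_zero:
  assumes "v \<in> tangent_space M x"
  shows "v (\<lambda>_. 0) = 0"
proof (cases "(\<lambda>_. 0) \<in> smooth_functions M")
  case True
  moreover have "v (\<lambda>y. c * f y) = c * v f" if "f \<in> smooth_functions M" for c f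
    using assms that by (simp add: tangent_space_def)
  ultimately have "v (\<lambda>_. 0 * 0) = 0 * v (\<lambda>_. 0)" by blast
  then show ?thesis by simp
next
  case False
  then show ?thesis using assms by (simp add: tangent_space_def)
qed

text \<open>
  By the Leibniz rule, multiplication by a function with value \<open>1\<close> at \<open>x\<close> does not change the
  derivative of a function vanishing at \<open>x\<close>. The two consequences below localise derivations
  with it.
\<close>

lemma tangent_space_times_bump:
  assumes "v \<in> tangent_space M x" "f \<in> smooth_functions M" "h \<in> smooth_functions M"
    and "f x = 0" "h x = 1"
  shows "v (\<lambda>y. f y * h y) = v f"
proof -
  have "v (\<lambda>y. f y * h y) = f x * v h + h x * v f"
    using assms(1-3) by (simp add: tangent_space_def)
  then show ?thesis using assms(4,5) by simp
qed

lemma tangent_space_local: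
  assumes M: "smooth_manifold M" and v: "v \<in> tangent_space M x" and f: "f \<in> smooth_functions M"
    and N: "openin (mtop M) N" "x \<in> N" "\<And>y. y \<in> N \<Longrightarrow> f y = 0"
  shows "v f = 0"
proof -
  obtain h K N' where h: "h \<in> smooth_functions M" "closedin (mtop M) K" "K \<subseteq> N"
    "openin (mtop M) N'" "x \<in> N'" "N' \<subseteq> N" "\<forall>y\<in>N'. h y = 1" "\<forall>y. y \<notin> K \<longrightarrow> h y = 0"
    by (rule smooth_function_bump[OF M N(1,2)])
  have "f y * h y = 0" for y using h(3,8) N(3) by (cases "y \<in> K") auto
  then have "(\<lambda>y. f y * h y) = (\<lambda>_. 0)" by blast
  then have "v f = v (\<lambda>_. 0)"
    using tangent_space_times_bump[OF v f h(1)] N(2,3) h(5,7) by simp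
  then show ?thesis using tangent_space_zero[OF v] by simp
qed

text \<open>
  A cut-off replaces \<open>f\<close> by a function that vanishes on all of \<open>S\<close>, on which a vector tangent to \<open>S\<close>
  acts as on the zero function of \<open>S\<close>.
\<close>

lemma tangent_subspace_annihilates:
  assumes M: "smooth_manifold M" and v: "v \<in> tangent_subspace M S s" and s: "s \<in> carrier S"
    and f: "f \<in> smooth_functions M"
    and N: "openin (mtop M) N" "s \<in> N" "\<And>y. y \<in> N \<Longrightarrow> y \<in> carrier S \<Longrightarrow> f y = 0"
  shows "v f = 0"
proof -
  obtain w where w: "v \<in> tangent_space M s" "w \<in> tangent_space S s"
    "\<forall>f\<in>smooth_functions M. v f = w (restr (carrier S) f)"
    using v unfolding tangent_subspace_def by blast
  obtain h K N' where h: "h \<in> smooth_functions M" "closedin (mtop M) K" "K \<subseteq> N"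
    "openin (mtop M) N'" "s \<in> N'" "N' \<subseteq> N" "\<forall>y\<in>N'. h y = 1" "\<forall>y. y \<notin> K \<longrightarrow> h y = 0"
    by (rule smooth_function_bump[OF M N(1,2)])
  have "f y * h y = 0" if "y \<in> carrier S" for y using h(3,8) N(3) that by (cases "y \<in> K") auto
  then have "restr (carrier S) (\<lambda>y. f y * h y) = (\<lambda>_. 0)" by (auto simp: restr_def)
  then have "v (\<lambda>y. f y * h y) = w (\<lambda>_. 0)"
    using w(3) smooth_functions_mult[OF M f h(1)] by simp
  moreover have "v (\<lambda>y. f y * h y) = v f"
    using tangent_space_times_bump[OF w(1) f h(1)] N(2,3) s h(5,7) by simp
  ultimately show ?thesis using tangent_space_zero[OF w(2)] by simp
qed

section \<open>Linear algebra\<close>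

text \<open>
  The inclusion \<open>B\<^sup>\<bottom>\<^sup>\<bottom> \<subseteq> span B\<close> for a finite set \<open>B\<close> and a non-degenerate form. Elements of \<open>B\<close> are
  removed one at a time: if \<open>b c\<close> is not zero on \<open>(B - {c})\<^sup>\<bottom>\<close>, a suitable multiple of \<open>c\<close> is
  subtracted from \<open>u\<close>. What remains at \<open>B = {}\<close> is non-degeneracy.
\<close>

lemma mem_span_if_orthogonal:
  fixes b :: "'v::real_vector \<Rightarrow> 'v \<Rightarrow> real"
  assumes F: "subspace F" and lin: "\<And>e. e \<in> F \<Longrightarrow> linear_map_on F (b e)"
    and sym: "\<And>e e'. e \<in> F \<Longrightarrow> e' \<in> F \<Longrightarrow> b e e' = b e' e"
    and nondeg: "\<And>e. e \<in> F \<Longrightarrow> (\<forall>e'\<in>F. b e e' = 0) \<Longrightarrow> e = 0"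
    and "finite B" "B \<subseteq> F" "u \<in> F"
    and "\<And>e. e \<in> F \<Longrightarrow> \<forall>c\<in>B. b c e = 0 \<Longrightarrow> b u e = 0"
  shows "u \<in> span B"
  using assms(5-8)
proof (induction B arbitrary: u rule: finite_induct)
  case empty
  then have "u = 0" using nondeg by simp
  then show ?case by (simp add: span_zero)
next
  case (insert c B)
  then have c: "c \<in> F" "B \<subseteq> F" by auto
  have diff: "b e (y - k *\<^sub>R z) = b e y - k * b e z" if "e \<in> F" "y \<in> F" "z \<in> F" for e y z k
  proof -
    have "(- k) *\<^sub>R z \<in> F" using F that(3) by (rule subspace_scale)
    then have "b e (y + (- k) *\<^sub>R z) = b e y + b e ((- k) *\<^sub>R z)"
      by (rule linear_map_onD(1)[OF lin[OF that(1)] that(2)])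
    also have "b e ((- k) *\<^sub>R z) = (- k) *\<^sub>R b e z"
      by (rule linear_map_onD(2)[OF lin[OF that(1)] that(3)])
    finally have "b e (y + (- k) *\<^sub>R z) = b e y + (- k) * b e z" by simp
    then show ?thesis by simp
  qed
  show ?case
  proof (cases "\<forall>e\<in>F. (\<forall>a\<in>B. b a e = 0) \<longrightarrow> b c e = 0")
    case True
    have "u \<in> span B"
      by (rule insert.IH[OF c(2) insert.prems(2)]) (use insert.prems(3) True in auto)
    then show ?thesis using span_mono[of B "insert c B"] by blast
  next
    case False
    then obtain e1 where e1: "e1 \<in> F" "\<forall>a\<in>B. b a e1 = 0" "b c e1 \<noteq> 0" by blast
    \<comment> \<open>the coefficient for which \<open>u - t c\<close> is orthogonal to \<open>e1\<close>, and then to all of \<open>(B - {c})\<^sup>\<bottom>\<close>\<close>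
    define t where "t = b u e1 / b c e1"
    have utc: "u - t *\<^sub>R c \<in> F"
      using F insert.prems(2) c(1) by (intro subspace_diff subspace_scale)
    have "u - t *\<^sub>R c \<in> span B"
    proof (rule insert.IH[OF c(2) utc])
      fix e assume e: "e \<in> F" "\<forall>a\<in>B. b a e = 0"
      define k where "k = b c e / b c e1"
      have ek: "e - k *\<^sub>R e1 \<in> F" using F e(1) e1(1) by (intro subspace_diff subspace_scale)
      have "b a (e - k *\<^sub>R e1) = 0" if "a \<in> insert c B" for a
        using that diff[OF _ e(1) e1(1), of a k] e(2) e1(2,3) c by (auto simp: k_def)
      then have "b u (e - k *\<^sub>R e1) = 0" using insert.prems(3)[OF ek] by blast
      then have "b u e = k * b u e1" using diff[OF insert.prems(2) e(1) e1(1)] by simp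
      also have "\<dots> = t * b c e" by (simp add: k_def t_def)
      finally have "b e u = t * b e c" using sym e(1) insert.prems(2) c(1) by simp
      then have "b e (u - t *\<^sub>R c) = 0" using diff[OF e(1) insert.prems(2) c(1)] by simp
      then show "b (u - t *\<^sub>R c) e = 0" using sym[OF e(1) utc] by simp
    qed
    then show ?thesis by (auto simp: span_insert)
  qed
qed

section \<open>Courant algebroids\<close>

locale courant =
  fixes M :: "('m, 'b::euclidean_space) manifold"
    and E :: "('m, 'v::real_vector, 'f::euclidean_space) vbundle"
    and \<rho> :: "('m, 'v) anchor" and g :: "('m, 'v) metric" and br :: "('m, 'v) bracket"
  assumes courant: "courant_algebroid M E \<rho> g br"
begin

sublocale smooth_bundle M E
  by unfold_locales (use courant in \<open>simp_all add: courant_algebroid_def\<close>)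

lemma pairing_at: "x \<in> carrier M \<Longrightarrow> pairing M g \<psi> \<psi>' x = g x (\<psi> x) (\<psi>' x)"
  by (simp add: pairing_def restr_def)

lemma metric_linear:
  assumes "x \<in> carrier M" "e \<in> fibre E x"
  shows "linear_map_on (fibre E x) (g x e)"
  using courant assms by (simp add: courant_algebroid_def fibre_metric_def)

lemma metric_sym:
  assumes "x \<in> carrier M" "e \<in> fibre E x" "e' \<in> fibre E x"
  shows "g x e e' = g x e' e"
  using courant assms by (simp add: courant_algebroid_def fibre_metric_def)

lemma metric_nondegenerate:
  assumes "x \<in> carrier M" "e \<in> fibre E x" "\<forall>e'\<in>fibre E x. g x e e' = 0"
  shows "e = 0"
  using courant assms by (simp add: courant_algebroid_def fibre_metric_def)

lemma metric_lincomb_right: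
  assumes "x \<in> carrier M" "e \<in> fibre E x" "e1 \<in> fibre E x" "e2 \<in> fibre E x"
  shows "g x e (a *\<^sub>R e1 + b *\<^sub>R e2) = a * g x e e1 + b * g x e e2"
proof -
  note lin = metric_linear[OF assms(1,2)]
  have "a *\<^sub>R e1 \<in> fibre E x" "b *\<^sub>R e2 \<in> fibre E x"
    using subspace_scale[OF fibre_subspace[OF assms(1)]] assms(3,4) by blast+
  then show ?thesis
    using linear_map_onD(1)[OF lin] linear_map_onD(2)[OF lin] assms(3,4) by simp
qed

lemma metric_lincomb_left:
  assumes "x \<in> carrier M" "e \<in> fibre E x" "e1 \<in> fibre E x" "e2 \<in> fibre E x"
  shows "g x (a *\<^sub>R e1 + b *\<^sub>R e2) e = a * g x e1 e + b * g x e2 e"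
proof -
  have "a *\<^sub>R e1 + b *\<^sub>R e2 \<in> fibre E x"
    using fibre_subspace[OF assms(1)] assms(3,4) by (intro subspace_add subspace_scale)
  then show ?thesis
    using metric_lincomb_right[OF assms, of a b] metric_sym[OF assms(1)] assms(2-4) by simp
qed

lemma pairing_smooth:
  assumes "\<psi> \<in> \<Gamma>" "\<psi>' \<in> \<Gamma>"
  shows "pairing M g \<psi> \<psi>' \<in> smooth_functions M"
  using courant assms by (simp add: courant_algebroid_def fibre_metric_def)

lemma anchor_tangent:
  assumes "x \<in> carrier M" "e \<in> fibre E x"
  shows "\<rho> x e \<in> tangent_space M x"
  using courant assms by (simp add: courant_algebroid_def anchor_map_def)

lemma bracket_section:
  assumes "\<psi> \<in> \<Gamma>" "\<psi>' \<in> \<Gamma>"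
  shows "br \<psi> \<psi>' \<in> \<Gamma>"
  using courant assms by (simp add: courant_algebroid_def bilinear_bracket_def Let_def)

lemma bracket_bilinear:
  assumes "\<psi> \<in> \<Gamma>" "\<psi>' \<in> \<Gamma>" "\<psi>'' \<in> \<Gamma>"
  shows "br (\<lambda>x. a *\<^sub>R \<psi> x + b *\<^sub>R \<psi>' x) \<psi>'' = (\<lambda>x. a *\<^sub>R br \<psi> \<psi>'' x + b *\<^sub>R br \<psi>' \<psi>'' x)"
    "br \<psi>'' (\<lambda>x. a *\<^sub>R \<psi> x + b *\<^sub>R \<psi>' x) = (\<lambda>x. a *\<^sub>R br \<psi>'' \<psi> x + b *\<^sub>R br \<psi>'' \<psi>' x)"
proof -
  have "bilinear_bracket M E br" using courant by (simp add: courant_algebroid_def)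
  then show "br (\<lambda>x. a *\<^sub>R \<psi> x + b *\<^sub>R \<psi>' x) \<psi>'' = (\<lambda>x. a *\<^sub>R br \<psi> \<psi>'' x + b *\<^sub>R br \<psi>' \<psi>'' x)"
    "br \<psi>'' (\<lambda>x. a *\<^sub>R \<psi> x + b *\<^sub>R \<psi>' x) = (\<lambda>x. a *\<^sub>R br \<psi>'' \<psi> x + b *\<^sub>R br \<psi>'' \<psi>' x)"
    using assms unfolding bilinear_bracket_def Let_def by blast+
qed

lemma bracket_leibniz:
  assumes "\<psi> \<in> \<Gamma>" "\<psi>' \<in> \<Gamma>" "f \<in> smooth_functions M" "x \<in> carrier M"
  shows "br \<psi> (\<lambda>y. f y *\<^sub>R \<psi>' y) x = f x *\<^sub>R br \<psi> \<psi>' x + \<rho> x (\<psi> x) f *\<^sub>R \<psi>' x"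
proof -
  have "br \<psi> (\<lambda>x. f x *\<^sub>R \<psi>' x) =
      (\<lambda>x. f x *\<^sub>R br \<psi> \<psi>' x + lie_derivative M \<rho> \<psi> f x *\<^sub>R \<psi>' x)"
    using courant assms(1-3) unfolding courant_algebroid_def Let_def by blast
  then show ?thesis using assms(4) by (simp add: lie_derivative_def restr_def)
qed

lemma metric_invariance:
  assumes "\<psi> \<in> \<Gamma>" "\<psi>' \<in> \<Gamma>" "\<psi>'' \<in> \<Gamma>" "x \<in> carrier M"
  shows "\<rho> x (\<psi> x) (pairing M g \<psi>' \<psi>'') =
    g x (br \<psi> \<psi>' x) (\<psi>'' x) + g x (\<psi>' x) (br \<psi> \<psi>'' x)"
proof -
  have "lie_derivative M \<rho> \<psi> (pairing M g \<psi>' \<psi>'') =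
      (\<lambda>x. pairing M g (br \<psi> \<psi>') \<psi>'' x + pairing M g \<psi>' (br \<psi> \<psi>'') x)"
    using courant assms(1-3) unfolding courant_algebroid_def Let_def by blast
  then have "lie_derivative M \<rho> \<psi> (pairing M g \<psi>' \<psi>'') x =
      pairing M g (br \<psi> \<psi>') \<psi>'' x + pairing M g \<psi>' (br \<psi> \<psi>'') x" by simp
  then show ?thesis using assms(4) by (simp add: lie_derivative_def restr_def pairing_at)
qed

lemma bracket_self:
  assumes "\<psi> \<in> \<Gamma>" "e \<in> \<Gamma>" "x \<in> carrier M"
  shows "2 * g x (br \<psi> \<psi> x) (e x) = \<rho> x (e x) (pairing M g \<psi> \<psi>)"
proof -
  have "pairing M g (br \<psi> \<psi>) e = (\<lambda>x. 1 / 2 * lie_derivative M \<rho> e (pairing M g \<psi> \<psi>) x)"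
    using courant assms(1,2) unfolding courant_algebroid_def Let_def by blast
  then have "pairing M g (br \<psi> \<psi>) e x = 1 / 2 * lie_derivative M \<rho> e (pairing M g \<psi> \<psi>) x" by simp
  then show ?thesis using assms(3) by (simp add: lie_derivative_def restr_def pairing_at)
qed

lemma tangent_space_add:
  assumes "v \<in> tangent_space M x" "f \<in> smooth_functions M" "h \<in> smooth_functions M"
  shows "v (\<lambda>y. f y + h y) = v f + v h"
  using assms by (simp add: tangent_space_def)

text \<open>
  Polarisation of the axiom on \<open>[\<psi>,\<psi>]\<close>: the failure of the bracket to be skew is a gradient, and it
  is invisible to any \<open>e\<close> whose anchor annihilates \<open>\<langle>\<psi>,\<phi>\<rangle>\<close>.
\<close>

lemma bracket_symmetric_part:
  assumes \<psi>: "\<psi> \<in> \<Gamma>" and \<phi>: "\<phi> \<in> \<Gamma>" and e: "e \<in> \<Gamma>" and x: "x \<in> carrier M"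
  shows "g x (br \<psi> \<phi> x) (e x) + g x (br \<phi> \<psi> x) (e x) = \<rho> x (e x) (pairing M g \<psi> \<phi>)"
proof -
  define \<zeta> where "\<zeta> = (\<lambda>x. 1 *\<^sub>R \<psi> x + 1 *\<^sub>R \<phi> x)"
  have \<zeta>: "\<zeta> \<in> \<Gamma>" unfolding \<zeta>_def by (rule section_lincomb[OF \<psi> \<phi>])
  have fib: "br \<psi> \<psi> x \<in> fibre E x" "br \<psi> \<phi> x \<in> fibre E x" "br \<phi> \<psi> x \<in> fibre E x"
    "br \<phi> \<phi> x \<in> fibre E x" "e x \<in> fibre E x"
    by (intro section_in_fibre[OF _ x] bracket_section \<psi> \<phi> e)+
  note F = fibre_subspace[OF x]
  let ?v = "\<rho> x (e x)"
  have v: "?v \<in> tangent_space M x" by (rule anchor_tangent[OF x fib(5)])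
  have left: "br \<zeta> \<zeta> x = 1 *\<^sub>R (1 *\<^sub>R br \<psi> \<psi> x + 1 *\<^sub>R br \<psi> \<phi> x)
      + 1 *\<^sub>R (1 *\<^sub>R br \<phi> \<psi> x + 1 *\<^sub>R br \<phi> \<phi> x)"
  proof -
    have "br \<zeta> \<zeta> = (\<lambda>x. 1 *\<^sub>R br \<psi> \<zeta> x + 1 *\<^sub>R br \<phi> \<zeta> x)"
      using bracket_bilinear(1)[OF \<psi> \<phi> \<zeta>, of 1 1] unfolding \<zeta>_def .
    moreover have "br \<psi> \<zeta> = (\<lambda>x. 1 *\<^sub>R br \<psi> \<psi> x + 1 *\<^sub>R br \<psi> \<phi> x)"
      unfolding \<zeta>_def by (rule bracket_bilinear(2)[OF \<psi> \<phi> \<psi>])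
    moreover have "br \<phi> \<zeta> = (\<lambda>x. 1 *\<^sub>R br \<phi> \<psi> x + 1 *\<^sub>R br \<phi> \<phi> x)"
      unfolding \<zeta>_def by (rule bracket_bilinear(2)[OF \<psi> \<phi> \<phi>])
    ultimately show ?thesis by simp
  qed
  have "1 *\<^sub>R br \<psi> \<psi> x + 1 *\<^sub>R br \<psi> \<phi> x \<in> fibre E x" "1 *\<^sub>R br \<phi> \<psi> x + 1 *\<^sub>R br \<phi> \<phi> x \<in> fibre E x"
    by (intro subspace_add[OF F] subspace_scale[OF F] fib)+
  then have left2: "g x (br \<zeta> \<zeta> x) (e x) = g x (br \<psi> \<psi> x) (e x) + g x (br \<psi> \<phi> x) (e x)
      + (g x (br \<phi> \<psi> x) (e x) + g x (br \<phi> \<phi> x) (e x))"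
    unfolding left
    using metric_lincomb_left[OF x fib(5) fib(1,2), of 1 1] metric_lincomb_left[OF x fib(5) fib(3,4), of 1 1]
      metric_lincomb_left[OF x fib(5), of _ _ 1 1] by simp
  have expand: "pairing M g \<zeta> \<zeta> = (\<lambda>y. pairing M g \<psi> \<psi> y + (pairing M g \<psi> \<phi> y + (pairing M g \<psi> \<phi> y + pairing M g \<phi> \<phi> y)))"
  proof
    fix y
    show "pairing M g \<zeta> \<zeta> y = pairing M g \<psi> \<psi> y + (pairing M g \<psi> \<phi> y + (pairing M g \<psi> \<phi> y + pairing M g \<phi> \<phi> y))"
    proof (cases "y \<in> carrier M")
      case True
      note f = section_in_fibre[OF \<psi> True] section_in_fibre[OF \<phi> True] section_in_fibre[OF \<zeta> True]
      have "g y (\<zeta> y) (\<zeta> y) = 1 * g y (\<zeta> y) (\<psi> y) + 1 * g y (\<zeta> y) (\<phi> y)"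
        using metric_lincomb_right[OF True f(3) f(1,2), of 1 1] by (simp add: \<zeta>_def)
      moreover have "g y (\<zeta> y) (\<psi> y) = 1 * g y (\<psi> y) (\<psi> y) + 1 * g y (\<phi> y) (\<psi> y)"
        using metric_lincomb_left[OF True f(1) f(1,2), of 1 1] by (simp add: \<zeta>_def)
      moreover have "g y (\<zeta> y) (\<phi> y) = 1 * g y (\<psi> y) (\<phi> y) + 1 * g y (\<phi> y) (\<phi> y)"
        using metric_lincomb_left[OF True f(2) f(1,2), of 1 1] by (simp add: \<zeta>_def)
      ultimately show ?thesis
        using metric_sym[OF True f(1,2)] True by (simp add: pairing_at)
    next
      case False
      then show ?thesis by (simp add: pairing_def restr_def)
    qed
  qed
  have sm: "pairing M g \<psi> \<psi> \<in> smooth_functions M" "pairing M g \<psi> \<phi> \<in> smooth_functions M"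
    "pairing M g \<phi> \<phi> \<in> smooth_functions M" by (intro pairing_smooth \<psi> \<phi>)+
  note sm2 = smooth_functions_add[OF manifold sm(2,3)]
  note sm3 = smooth_functions_add[OF manifold sm(2) sm2]
  have "?v (pairing M g \<zeta> \<zeta>) = ?v (pairing M g \<psi> \<psi>)
      + (?v (pairing M g \<psi> \<phi>) + (?v (pairing M g \<psi> \<phi>) + ?v (pairing M g \<phi> \<phi>)))"
    unfolding expand tangent_space_add[OF v sm(1) sm3] tangent_space_add[OF v sm(2) sm2]
      tangent_space_add[OF v sm(2,3)] ..
  then show ?thesis
    using left2 bracket_self[OF \<zeta> e x] bracket_self[OF \<psi> e x] bracket_self[OF \<phi> e x] by simp
qed

text \<open>
  The Leibniz rule for \<open>h \<zeta> = 0\<close>, where \<open>h\<close> is a bump at \<open>x\<close> supported where \<open>\<zeta>\<close> vanishes.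
\<close>

lemma bracket_local_right:
  assumes \<phi>: "\<phi> \<in> \<Gamma>" and \<zeta>: "\<zeta> \<in> \<Gamma>"
    and N: "openin (mtop M) N" "x \<in> N" "\<forall>y\<in>N. \<zeta> y = 0"
  shows "br \<phi> \<zeta> x = 0"
proof -
  have x: "x \<in> carrier M" using open_subset_carrier[OF N(1)] N(2) by blast
  obtain h K N' where h: "h \<in> smooth_functions M" "closedin (mtop M) K" "K \<subseteq> N"
    "openin (mtop M) N'" "x \<in> N'" "N' \<subseteq> N" "\<forall>y\<in>N'. h y = 1" "\<forall>y. y \<notin> K \<longrightarrow> h y = 0"
    by (rule smooth_function_bump[OF manifold N(1,2)])
  have "h y *\<^sub>R \<zeta> y = 0" for y using h(3,8) N(3) by (cases "y \<in> K") auto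
  then have "(\<lambda>y. h y *\<^sub>R \<zeta> y) = (\<lambda>y. 0 *\<^sub>R \<phi> y + 0 *\<^sub>R \<phi> y)" by auto
  then have "br \<phi> (\<lambda>y. h y *\<^sub>R \<zeta> y) x = 0"
    using bracket_bilinear(2)[OF \<phi> \<phi> \<phi>, of 0 0] by simp
  moreover have "br \<phi> (\<lambda>y. h y *\<^sub>R \<zeta> y) x = h x *\<^sub>R br \<phi> \<zeta> x + \<rho> x (\<phi> x) h *\<^sub>R \<zeta> x"
    by (rule bracket_leibniz[OF \<phi> \<zeta> h(1) x])
  ultimately show ?thesis using h(5,7) N(2,3) by simp
qed

text \<open>
  The Leibniz axiom concerns the second argument of the bracket. Exchanging the arguments costs a gradient
  term, which vanishes at \<open>x\<close> because \<open>\<langle>\<zeta>,\<phi>\<rangle>\<close> vanishes near \<open>x\<close>.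
\<close>

lemma bracket_local_left:
  assumes \<phi>: "\<phi> \<in> \<Gamma>" and \<zeta>: "\<zeta> \<in> \<Gamma>"
    and N: "openin (mtop M) N" "x \<in> N" "\<forall>y\<in>N. \<zeta> y = 0"
  shows "br \<zeta> \<phi> x = 0"
proof -
  have x: "x \<in> carrier M" using open_subset_carrier[OF N(1)] N(2) by blast
  note F = fibre_subspace[OF x]
  have "g x (br \<zeta> \<phi> x) e0 = 0" if e0: "e0 \<in> fibre E x" for e0
  proof -
    obtain e where e: "e \<in> \<Gamma>" "e x = e0" by (rule section_through_point[OF x e0])
    have zero: "g y a 0 = 0" "g y 0 a = 0" if "y \<in> carrier M" "a \<in> fibre E y" for y a
      using metric_lincomb_right[OF that that(2) that(2), of 0 0]
        metric_lincomb_left[OF that that(2) that(2), of 0 0] by simp_all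
    have "\<rho> x (e x) (pairing M g \<zeta> \<phi>) = 0"
    proof (rule tangent_space_local[OF manifold anchor_tangent[OF x section_in_fibre[OF e(1) x]]
            pairing_smooth[OF \<zeta> \<phi>] N(1,2)])
      fix y assume y: "y \<in> N"
      then have yM: "y \<in> carrier M" using open_subset_carrier[OF N(1)] by blast
      show "pairing M g \<zeta> \<phi> y = 0"
        using zero(2)[OF yM section_in_fibre[OF \<phi> yM]] N(3) y pairing_at[OF yM] by simp
    qed
    then have "g x (br \<zeta> \<phi> x) (e x) + g x (br \<phi> \<zeta> x) (e x) = 0"
      using bracket_symmetric_part[OF \<zeta> \<phi> e(1) x] by simp
    moreover have "br \<phi> \<zeta> x = 0" by (rule bracket_local_right[OF \<phi> \<zeta> N])
    ultimately show ?thesis using zero(2)[OF x e0] e(2) by simp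
  qed
  then show ?thesis
    using metric_nondegenerate[OF x section_in_fibre[OF bracket_section[OF \<zeta> \<phi>] x]] by blast
qed

lemma bracket_local:
  assumes \<phi>: "\<phi> \<in> \<Gamma>" "\<phi>' \<in> \<Gamma>" and \<zeta>: "\<zeta> \<in> \<Gamma>" "\<zeta>' \<in> \<Gamma>"
    and N: "openin (mtop M) N" "x \<in> N" "\<forall>y\<in>N. \<phi> y = \<zeta> y \<and> \<phi>' y = \<zeta>' y"
  shows "br \<phi> \<phi>' x = br \<zeta> \<zeta>' x"
proof -
  let ?d = "\<lambda>y. 1 *\<^sub>R \<phi> y + (- 1) *\<^sub>R \<zeta> y" and ?d' = "\<lambda>y. 1 *\<^sub>R \<phi>' y + (- 1) *\<^sub>R \<zeta>' y"
  have "br ?d \<phi>' x = 0"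
    by (rule bracket_local_left[OF \<phi>(2) section_lincomb[OF \<phi>(1) \<zeta>(1)] N(1,2)]) (use N(3) in simp)
  then have "br \<phi> \<phi>' x = br \<zeta> \<phi>' x" using bracket_bilinear(1)[OF \<phi>(1) \<zeta>(1) \<phi>(2), of 1 "- 1"] by simp
  moreover have "br \<zeta> ?d' x = 0"
    by (rule bracket_local_right[OF \<zeta>(1) section_lincomb[OF \<phi>(2) \<zeta>(2)] N(1,2)]) (use N(3) in simp)
  then have "br \<zeta> \<phi>' x = br \<zeta> \<zeta>' x" using bracket_bilinear(2)[OF \<phi>(2) \<zeta>(2) \<zeta>(1), of 1 "- 1"] by simp
  ultimately show ?thesis by simp
qed

lemma local_bracket_eq:
  assumes \<phi>: "\<phi> \<in> \<Gamma>" "\<phi>' \<in> \<Gamma>"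
    and N: "openin (mtop M) N" "x \<in> N" "N \<subseteq> U" "\<forall>y\<in>N. \<phi> y = \<psi> y \<and> \<phi>' y = \<psi>' y"
  shows "local_bracket M E br U \<psi> \<psi>' x = br \<phi> \<phi>' x"
proof -
  let ?P = "\<lambda>v. \<exists>\<phi>\<in>\<Gamma>. \<exists>\<phi>'\<in>\<Gamma>.
       (\<exists>N. openin (mtop M) N \<and> x \<in> N \<and> N \<subseteq> U \<and> (\<forall>y\<in>N. \<phi> y = \<psi> y \<and> \<phi>' y = \<psi>' y)) \<and>
       v = br \<phi> \<phi>' x"
  have "(THE v. ?P v) = br \<phi> \<phi>' x"
  proof (rule the_equality)
    show "?P (br \<phi> \<phi>' x)" using \<phi> N by blast
    fix v assume "?P v"
    then obtain \<zeta> \<zeta>' N' where \<zeta>: "\<zeta> \<in> \<Gamma>" "\<zeta>' \<in> \<Gamma>" "openin (mtop M) N'" "x \<in> N'"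
      "\<forall>y\<in>N'. \<zeta> y = \<psi> y \<and> \<zeta>' y = \<psi>' y" "v = br \<zeta> \<zeta>' x" by (elim bexE exE conjE)
    have "br \<zeta> \<zeta>' x = br \<phi> \<phi>' x"
      by (rule bracket_local[OF \<zeta>(1,2) \<phi> openin_Int[OF N(1) \<zeta>(3)]]) (use N \<zeta> in auto)
    then show "v = br \<phi> \<phi>' x" using \<zeta>(6) by simp
  qed
  then show ?thesis using N(2,3) by (simp add: local_bracket_def restr_def subset_iff)
qed

text \<open>
  The extension of a vector orthogonal to the frame at one point to a section orthogonal to it
  everywhere. By induction there are global sections \<open>e'\<close> and \<open>\<eta>\<close>, orthogonal to \<open>\<psi>\<^sub>0, \<dots>, \<psi>\<^sub>r\<^sub>-\<^sub>1\<close>, with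
  \<open>e' x = e0\<close> and \<open>\<langle>\<psi>\<^sub>r, \<eta>\<rangle> = 1\<close> at \<open>x\<close>. Then \<open>e = \<langle>\<psi>\<^sub>r,\<eta>\<rangle> e' - \<langle>\<psi>\<^sub>r,e'\<rangle> \<eta>\<close> is also orthogonal to \<open>\<psi>\<^sub>r\<close>,
  and \<open>e x = e0\<close> since \<open>\<langle>\<psi>\<^sub>r,e0\<rangle> = 0\<close> at \<open>x\<close>.
  This elimination is free of division and hence stays within the module of global sections over
  the smooth functions on \<open>M\<close>.
\<close>

lemma orthogonal_extension:
  fixes r :: nat
  assumes x: "x \<in> carrier M"
    and "\<And>\<mu>. \<mu> < r \<Longrightarrow> \<psi> \<mu> \<in> \<Gamma>"
    and "inj_on (\<lambda>\<mu>. \<psi> \<mu> x) {..<r}" "independent ((\<lambda>\<mu>. \<psi> \<mu> x) ` {..<r})"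
    and "e0 \<in> fibre E x" "\<And>\<mu>. \<mu> < r \<Longrightarrow> g x (\<psi> \<mu> x) e0 = 0"
  shows "\<exists>e\<in>\<Gamma>. e x = e0 \<and> (\<forall>\<mu><r. \<forall>y\<in>carrier M. g y (\<psi> \<mu> y) (e y) = 0)"
  using assms(2-)
proof (induction r arbitrary: e0)
  case 0
  then show ?case using section_through_point[OF x] by (metis not_less_zero)
next
  case (Suc r)
  let ?B = "(\<lambda>\<mu>. \<psi> \<mu> x) ` {..<r}"
  have image: "(\<lambda>\<mu>. \<psi> \<mu> x) ` {..<Suc r} = insert (\<psi> r x) ?B" by (simp add: lessThan_Suc)
  have \<psi>: "\<psi> \<mu> \<in> \<Gamma>" if "\<mu> \<le> r" for \<mu> using Suc.prems(1) that by simp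
  have inj: "inj_on (\<lambda>\<mu>. \<psi> \<mu> x) {..<r}" using Suc.prems(2) by (auto simp: lessThan_Suc)
  have fresh: "\<psi> r x \<notin> ?B" using Suc.prems(2) by (auto simp: lessThan_Suc inj_on_def)
  have ind: "independent ?B" and out: "\<psi> r x \<notin> span ?B"
    using Suc.prems(3) fresh unfolding image independent_insert by simp_all
  have BF: "?B \<subseteq> fibre E x" using section_in_fibre[OF \<psi> x] by auto
  have rF: "\<psi> r x \<in> fibre E x" by (rule section_in_fibre[OF \<psi> x]) simp
  \<comment> \<open>otherwise \<open>\<psi> r x\<close> would lie in the double orthogonal complement of the other vectors, that is, in their span\<close>
  have "\<exists>\<eta>\<in>fibre E x. (\<forall>c\<in>?B. g x c \<eta> = 0) \<and> g x (\<psi> r x) \<eta> \<noteq> 0"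
  proof (rule ccontr)
    assume "\<not> ?thesis"
    then have "\<psi> r x \<in> span ?B"
      by (intro mem_span_if_orthogonal[where b = "g x", OF fibre_subspace[OF x] metric_linear[OF x]
            metric_sym[OF x] metric_nondegenerate[OF x] _ BF rF]) auto
    then show False using out by blast
  qed
  then obtain \<eta>1 where \<eta>1: "\<eta>1 \<in> fibre E x" "\<forall>c\<in>?B. g x c \<eta>1 = 0" "g x (\<psi> r x) \<eta>1 \<noteq> 0" by blast
  define \<eta>0 where "\<eta>0 = (1 / g x (\<psi> r x) \<eta>1) *\<^sub>R \<eta>1"
  have \<eta>0: "\<eta>0 \<in> fibre E x" unfolding \<eta>0_def by (rule subspace_scale[OF fibre_subspace[OF x] \<eta>1(1)])
  have g\<eta>0: "g x a \<eta>0 = (1 / g x (\<psi> r x) \<eta>1) * g x a \<eta>1" if "a \<in> fibre E x" for a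
    unfolding \<eta>0_def using linear_map_onD(2)[OF metric_linear[OF x that] \<eta>1(1)] by simp
  have \<eta>0B: "g x (\<psi> \<mu> x) \<eta>0 = 0" if "\<mu> < r" for \<mu>
    using g\<eta>0[of "\<psi> \<mu> x"] BF \<eta>1(2) that by auto
  have \<eta>0r: "g x (\<psi> r x) \<eta>0 = 1" using g\<eta>0[OF rF] \<eta>1(3) by simp
  obtain \<eta> where \<eta>: "\<eta> \<in> \<Gamma>" "\<eta> x = \<eta>0" "\<forall>\<mu><r. \<forall>y\<in>carrier M. g y (\<psi> \<mu> y) (\<eta> y) = 0"
    using Suc.IH[OF Suc.prems(1) inj ind \<eta>0 \<eta>0B] by auto
  obtain e' where e': "e' \<in> \<Gamma>" "e' x = e0" "\<forall>\<mu><r. \<forall>y\<in>carrier M. g y (\<psi> \<mu> y) (e' y) = 0"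
    using Suc.IH[OF Suc.prems(1) inj ind Suc.prems(4) Suc.prems(5)] by auto
  let ?a = "pairing M g (\<psi> r) \<eta>" and ?c = "pairing M g (\<psi> r) e'"
  define e where "e = (\<lambda>y. 1 *\<^sub>R (?a y *\<^sub>R e' y) + (- 1) *\<^sub>R (?c y *\<^sub>R \<eta> y))"
  have e\<Gamma>: "e \<in> \<Gamma>"
    unfolding e_def by (intro section_lincomb section_scale pairing_smooth \<psi> \<eta>(1) e'(1) order_refl)
  have e_alt: "e y = ?a y *\<^sub>R e' y + (- ?c y) *\<^sub>R \<eta> y" for y by (simp add: e_def)
  have "?a x = 1" "?c x = 0"
    using \<eta>(2) \<eta>0r e'(2) Suc.prems(5)[of r] pairing_at[OF x] by simp_all
  then have ex: "e x = e0" using e'(2) by (simp add: e_alt)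
  have "g y (\<psi> \<mu> y) (e y) = 0" if \<mu>: "\<mu> < Suc r" and y: "y \<in> carrier M" for \<mu> y
  proof -
    have "\<psi> \<mu> y \<in> fibre E y" using section_in_fibre[OF \<psi> y] \<mu> by simp
    then have *: "g y (\<psi> \<mu> y) (e y) = ?a y * g y (\<psi> \<mu> y) (e' y) + (- ?c y) * g y (\<psi> \<mu> y) (\<eta> y)"
      unfolding e_alt
      by (intro metric_lincomb_right[OF y] section_in_fibre[OF e'(1) y] section_in_fibre[OF \<eta>(1) y])
    show ?thesis
    proof (cases "\<mu> = r")
      case True
      then show ?thesis using * pairing_at[OF y] by simp
    next
      case False
      then show ?thesis using * \<eta>(3) e'(3) \<mu> y by simp
    qed
  qed
  then show ?case using e\<Gamma> ex by blast
qed

end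

section \<open>Involutivity from frames\<close>

context courant
begin

lemma orthogonal_to_span:
  assumes x: "x \<in> carrier M" and e: "e \<in> fibre E x"
    and B: "\<And>c. c \<in> B \<Longrightarrow> c \<in> fibre E x \<and> g x c e = 0" and l: "l \<in> span B"
  shows "g x l e = 0"
proof -
  note F = fibre_subspace[OF x]
  have "l \<in> fibre E x \<and> g x l e = 0" using l
  proof (induction rule: span_induct_alt)
    case base
    show ?case using subspace_0[OF F] metric_lincomb_left[OF x e e e, of 0 0] by simp
  next
    case (step k c d)
    then have cd: "c \<in> fibre E x" "d \<in> fibre E x" "g x c e = 0" "g x d e = 0" using B by auto
    have "k *\<^sub>R c + 1 *\<^sub>R d \<in> fibre E x" by (intro subspace_add[OF F] subspace_scale[OF F] cd)
    then show ?case using metric_lincomb_left[OF x e cd(1,2), of k 1] cd(3,4) by simp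
  qed
  then show ?thesis ..
qed

lemma restrict_section:
  assumes S: "submanifold M S" and \<psi>: "\<psi> \<in> \<Gamma>"
  shows "restr (carrier M \<inter> carrier S) \<psi> \<in> sections S (restrict_bundle E S) (carrier M \<inter> carrier S)"
proof -
  let ?A = "carrier M \<inter> carrier S"
  have "smooth_map_on S (?A \<inter> (V \<inter> carrier S)) (\<lambda>x. \<Phi> x (restr ?A \<psi> x))"
    if V: "(V, \<Phi>) \<in> trivs E" for V \<Phi>
  proof (rule smooth_map_on_submanifold[OF manifold S])
    show sub: "carrier M \<inter> V \<subseteq> carrier M" by blast
    show "smooth_map_on M (carrier M \<inter> V) (\<lambda>x. \<Phi> x (\<psi> x))"
      by (rule iffD2[OF smooth_map_on_iff_germ[OF manifold sub]])
        (use section_germ[OF \<psi> order_refl V] in blast)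
  qed (auto simp: restr_def)
  then show ?thesis
    using section_in_fibre[OF \<psi>] by (auto simp: sections_def restrict_bundle_def restr_def)
qed

lemma almost_involutiveD:
  assumes "almost_involutive_structure M E \<rho> g S L r" and y: "y \<in> carrier S"
  shows "y \<in> carrier M" "L y \<subseteq> fibre E y"
    "\<lbrakk>a \<in> L y; b \<in> L y\<rbrakk> \<Longrightarrow> g y a b = 0"
    "\<lbrakk>a \<in> fibre E y; \<forall>l\<in>L y. g y a l = 0\<rbrakk> \<Longrightarrow> \<rho> y a \<in> tangent_subspace M S y"
    "a \<in> L y \<Longrightarrow> \<rho> y a \<in> tangent_subspace M S y"
proof -
  have S: "submanifold M S" "subbundle S (restrict_bundle E S) L r" "isotropic E g S L"
    "compatible_with_anchor M \<rho> S (orth E g L)"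
    using assms(1) by (simp_all add: almost_involutive_structure_def)
  show "y \<in> carrier M" using S(1) y by (auto simp: submanifold_def)
  show LF: "L y \<subseteq> fibre E y" using S(2) y by (simp add: subbundle_def restrict_bundle_def)
  have orth: "L y \<subseteq> orth E g L y" using S(3) y by (simp add: isotropic_def)
  then show "\<lbrakk>a \<in> L y; b \<in> L y\<rbrakk> \<Longrightarrow> g y a b = 0" by (auto simp: orth_def)
  have T: "\<rho> y ` orth E g L y \<subseteq> tangent_subspace M S y"
    using S(4) y by (simp add: compatible_with_anchor_def)
  then show "\<lbrakk>a \<in> fibre E y; \<forall>l\<in>L y. g y a l = 0\<rbrakk> \<Longrightarrow> \<rho> y a \<in> tangent_subspace M S y"
    by (auto simp: orth_def)
  show "a \<in> L y \<Longrightarrow> \<rho> y a \<in> tangent_subspace M S y" using T orth by blast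
qed

text \<open>
  Since \<open>L s\<close> is spanned by the frame, it suffices to test \<open>[\<psi>,\<psi>']\<close> at \<open>s\<close>
  against the vectors \<open>e0\<close> orthogonal to the frame. With the extension \<open>e\<close> of \<open>e0\<close> orthogonal to the
  frame everywhere, the number \<open>\<langle>[\<phi>,\<phi>'],e\<rangle>\<close> at \<open>s\<close> is skew in \<open>\<phi>, \<phi>'\<close> and depends on \<open>\<phi>'\<close> only
  through its value at \<open>s\<close>, for sections \<open>\<phi>, \<phi>'\<close> that lie in \<open>L\<close> along \<open>S\<close> near \<open>s\<close>. It is thus
  determined by its values on the frame, which are zero.
\<close>

lemma bracket_in_subbundle_at:
  fixes r :: nat
  assumes L: "almost_involutive_structure M E \<rho> g S L r" and s: "s \<in> carrier S"
    and N: "openin (mtop M) N" "s \<in> N"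
    and \<Psi>: "\<And>\<mu>. \<mu> < r \<Longrightarrow> \<Psi> \<mu> \<in> \<Gamma>"
    and inj: "inj_on (\<lambda>\<mu>. \<Psi> \<mu> s) {..<r}" and ind: "independent ((\<lambda>\<mu>. \<Psi> \<mu> s) ` {..<r})"
    and span: "\<And>y. y \<in> N \<Longrightarrow> y \<in> carrier S \<Longrightarrow> span ((\<lambda>\<mu>. \<Psi> \<mu> y) ` {..<r}) = L y"
    and frame_bracket: "\<And>\<mu> \<nu>. \<mu> < r \<Longrightarrow> \<nu> < r \<Longrightarrow> br (\<Psi> \<mu>) (\<Psi> \<nu>) s \<in> L s"
    and \<psi>: "\<psi> \<in> \<Gamma>" "\<forall>y\<in>carrier S. \<psi> y \<in> L y"
    and \<psi>': "\<psi>' \<in> \<Gamma>" "\<forall>y\<in>carrier S. \<psi>' y \<in> L y"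
  shows "br \<psi> \<psi>' s \<in> L s"
proof -
  \<comment> \<open>sections with values in \<open>L\<close> along \<open>S\<close> near \<open>s\<close>: they comprise \<open>\<psi>\<close>, \<open>\<psi>'\<close> and the frame\<close>
  define G where "G = {\<phi> \<in> \<Gamma>. \<forall>y\<in>N \<inter> carrier S. \<phi> y \<in> L y}"
  note LD = almost_involutiveD[OF L]
  note sM = LD(1)[OF s]
  note F = fibre_subspace[OF sM]
  let ?B = "(\<lambda>\<mu>. \<Psi> \<mu> s) ` {..<r}"
  have G: "\<phi> \<in> \<Gamma>" "\<phi> s \<in> L s" if "\<phi> \<in> G" for \<phi> using that N(2) s by (simp_all add: G_def)
  have \<Psi>L: "\<Psi> \<mu> y \<in> L y" if "\<mu> < r" "y \<in> N" "y \<in> carrier S" for \<mu> y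
    using span_base[of "\<Psi> \<mu> y" "(\<lambda>\<mu>. \<Psi> \<mu> y) ` {..<r}"] span[OF that(2,3)] that(1) by simp
  have \<Psi>G: "\<Psi> \<mu> \<in> G" if "\<mu> < r" for \<mu> using \<Psi> \<Psi>L that by (simp add: G_def)
  have \<psi>G: "\<psi> \<in> G" "\<psi>' \<in> G" using \<psi> \<psi>' by (simp_all add: G_def)
  have BF: "?B \<subseteq> fibre E s" using \<Psi>L[OF _ N(2) s] LD(2)[OF s] by auto
  have brF: "br \<phi> \<phi>' s \<in> fibre E s" if "\<phi> \<in> \<Gamma>" "\<phi>' \<in> \<Gamma>" for \<phi> \<phi>'
    using section_in_fibre[OF bracket_section[OF that] sM] .
  have "g s (br \<psi> \<psi>' s) e0 = 0" if e0: "e0 \<in> fibre E s" "\<forall>c\<in>?B. g s c e0 = 0" for e0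
  proof -
    have orth0: "g s (\<Psi> \<mu> s) e0 = 0" if "\<mu> < r" for \<mu> using e0(2) that by simp
    from orthogonal_extension[OF sM \<Psi> inj ind e0(1) orth0]
    obtain e where e: "e \<in> \<Gamma>" "e s = e0" "\<forall>\<mu><r. \<forall>y\<in>carrier M. g y (\<Psi> \<mu> y) (e y) = 0"
      by auto
    have eL: "g y l (e y) = 0" if y: "y \<in> N" "y \<in> carrier S" and l: "l \<in> L y" for y l
    proof -
      note yM = LD(1)[OF y(2)]
      note ey = section_in_fibre[OF e(1) yM]
      have frame: "c \<in> fibre E y \<and> g y c (e y) = 0" if "c \<in> (\<lambda>\<mu>. \<Psi> \<mu> y) ` {..<r}" for c
        using that e(3) yM section_in_fibre[OF \<Psi> yM] by auto
      show ?thesis by (rule orthogonal_to_span[OF yM ey frame]) (use l span[OF y] in auto)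
    qed
    \<comment> \<open>\<open>\<langle>\<phi>',e\<rangle>\<close> vanishes along \<open>S\<close> and \<open>\<rho>(\<phi>)\<close> is tangent to \<open>S\<close>; the right-hand side sees only \<open>\<phi>' s\<close>\<close>
    have tensor: "g s (br \<phi> \<phi>' s) e0 = - g s (\<phi>' s) (br \<phi> e s)" if "\<phi> \<in> G" "\<phi>' \<in> G" for \<phi> \<phi>'
    proof -
      have "\<rho> s (\<phi> s) (pairing M g \<phi>' e) = 0"
      proof (rule tangent_subspace_annihilates[OF manifold LD(5)[OF s G(2)[OF that(1)]] s
              pairing_smooth[OF G(1)[OF that(2)] e(1)] N])
        fix y assume y: "y \<in> N" "y \<in> carrier S"
        have "\<phi>' y \<in> L y" using that(2) y by (simp add: G_def)
        then show "pairing M g \<phi>' e y = 0" using pairing_at[OF LD(1)[OF y(2)]] eL[OF y] by simp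
      qed
      then show ?thesis using metric_invariance[OF G(1)[OF that(1)] G(1)[OF that(2)] e(1) sM] e(2) by simp
    qed
    have e0L: "\<forall>l\<in>L s. g s e0 l = 0"
    proof
      fix l assume l: "l \<in> L s"
      then have "l \<in> fibre E s" using LD(2)[OF s] by blast
      then show "g s e0 l = 0" using eL[OF N(2) s l] e(2) metric_sym[OF sM e0(1)] by simp
    qed
    \<comment> \<open>\<open>\<langle>\<phi>,\<phi>'\<rangle>\<close> vanishes along \<open>S\<close> by isotropy, and \<open>\<rho>(e0)\<close> is tangent to \<open>S\<close> as \<open>e0\<close> is orthogonal to \<open>L s\<close>\<close>
    have skew: "g s (br \<phi> \<phi>' s) e0 = - g s (br \<phi>' \<phi> s) e0" if "\<phi> \<in> G" "\<phi>' \<in> G" for \<phi> \<phi>'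
    proof -
      have "\<rho> s e0 (pairing M g \<phi> \<phi>') = 0"
      proof (rule tangent_subspace_annihilates[OF manifold LD(4)[OF s e0(1) e0L] s
              pairing_smooth[OF G(1)[OF that(1)] G(1)[OF that(2)]] N])
        fix y assume y: "y \<in> N" "y \<in> carrier S"
        have "\<phi> y \<in> L y" "\<phi>' y \<in> L y" using that y by (simp_all add: G_def)
        then show "pairing M g \<phi> \<phi>' y = 0" using pairing_at[OF LD(1)[OF y(2)]] LD(3)[OF y(2)] by simp
      qed
      then show ?thesis
        using bracket_symmetric_part[OF G(1)[OF that(1)] G(1)[OF that(2)] e(1) sM] e(2) by simp
    qed
    have from_frame: "g s (br \<phi> \<phi>' s) e0 = 0"
      if \<phi>: "\<phi> \<in> G" and \<phi>': "\<phi>' \<in> G" and zero: "\<And>\<nu>. \<nu> < r \<Longrightarrow> g s (br \<phi> (\<Psi> \<nu>) s) e0 = 0" for \<phi> \<phi>'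
    proof -
      note b = brF[OF G(1)[OF \<phi>] e(1)]
      have "c \<in> fibre E s \<and> g s c (br \<phi> e s) = 0" if c: "c \<in> ?B" for c
      proof -
        obtain \<nu> where \<nu>: "\<nu> < r" "c = \<Psi> \<nu> s" using c by auto
        then show ?thesis using tensor[OF \<phi> \<Psi>G[OF \<nu>(1)]] zero[OF \<nu>(1)] BF c by auto
      qed
      then have "g s (\<phi>' s) (br \<phi> e s) = 0"
        by (rule orthogonal_to_span[OF sM b]) (use G(2)[OF \<phi>'] span[OF N(2) s] in auto)
      then show ?thesis using tensor[OF \<phi> \<phi>'] by simp
    qed
    have frame: "g s (br (\<Psi> \<mu>) (\<Psi> \<nu>) s) e0 = 0" if "\<mu> < r" "\<nu> < r" for \<mu> \<nu>
      using eL[OF N(2) s frame_bracket[OF that]] e(2) by simp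
    \<comment> \<open>pass from the frame to arbitrary sections in one argument at a time, with a swap in between\<close>
    have "g s (br (\<Psi> \<mu>) \<psi> s) e0 = 0" if "\<mu> < r" for \<mu>
      using from_frame[OF \<Psi>G[OF that] \<psi>G(1)] frame[OF that] by blast
    then have "g s (br \<psi> (\<Psi> \<mu>) s) e0 = 0" if "\<mu> < r" for \<mu>
      using skew[OF \<psi>G(1) \<Psi>G[OF that]] that by simp
    then show ?thesis using from_frame[OF \<psi>G] by blast
  qed
  then have "br \<psi> \<psi>' s \<in> span ?B"
    by (intro mem_span_if_orthogonal[where b = "g s", OF F metric_linear[OF sM] metric_sym[OF sM]
          metric_nondegenerate[OF sM] _ BF brF[OF \<psi>(1) \<psi>'(1)]]) auto
  then show ?thesis using span[OF N(2) s] by simp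
qed

text \<open>
  The bump is supported where \<open>\<psi>\<close> is defined, and \<open>N\<close> is kept inside an open set \<open>V'\<close> of \<open>M\<close> that cuts out
  \<open>V\<close> on \<open>S\<close>, so that along \<open>S\<close> near \<open>s\<close> the new sections still coincide with the frame of \<open>L\<close>.
\<close>

lemma globalise_frame:
  assumes S: "submanifold M S" and s: "s \<in> V" and frame: "local_frame S (restrict_bundle E S) L r V \<sigma>"
    and U: "openin (mtop M) U" "V \<subseteq> U"
    and \<psi>: "\<forall>\<mu><r. \<psi> \<mu> \<in> sections M E U \<and> restr V (\<psi> \<mu>) = \<sigma> \<mu>"
  obtains N \<Psi> where "openin (mtop M) N" "s \<in> N" "N \<subseteq> U" "N \<inter> carrier S \<subseteq> V"
    "\<forall>\<mu><r. \<Psi> \<mu> \<in> \<Gamma> \<and> (\<forall>y\<in>N. \<Psi> \<mu> y = \<psi> \<mu> y)"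
proof -
  have "openin (subtopology (mtop M) (carrier S)) V"
    using frame S by (simp add: local_frame_def submanifold_def)
  then obtain V' where V': "openin (mtop M) V'" "V = V' \<inter> carrier S"
    by (auto simp: openin_subtopology)
  have W: "openin (mtop M) (U \<inter> V')" "s \<in> U \<inter> V'" using U V' s by auto
  obtain h K N where h: "h \<in> smooth_functions M" "closedin (mtop M) K" "K \<subseteq> U \<inter> V'"
    "openin (mtop M) N" "s \<in> N" "N \<subseteq> U \<inter> V'" "\<forall>y\<in>N. h y = 1" "\<forall>y. y \<notin> K \<longrightarrow> h y = 0"
    by (rule smooth_function_bump[OF manifold W])
  have KU: "K \<subseteq> U" using h(3) by blast
  show thesis
  proof (rule that[of N "\<lambda>\<mu> y. h y *\<^sub>R \<psi> \<mu> y"])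
    show "\<forall>\<mu><r. (\<lambda>y. h y *\<^sub>R \<psi> \<mu> y) \<in> \<Gamma> \<and> (\<forall>y\<in>N. h y *\<^sub>R \<psi> \<mu> y = \<psi> \<mu> y)"
      using section_extend_by_cutoff[OF _ U(1) h(1,2) KU h(8)] \<psi> h(7) by simp
  qed (use h V' in auto)
qed

end

theorem proposition2p23:
  fixes M S :: "('m, 'b::euclidean_space) manifold"
    and E :: "('m, 'v::real_vector, 'f::euclidean_space) vbundle"
    and \<rho> :: "('m, 'v) anchor" and g :: "('m, 'v) metric" and br :: "('m, 'v) bracket"
    and L :: "'m \<Rightarrow> 'v set" and r :: nat
  assumes "courant_algebroid M E \<rho> g br"
    and "almost_involutive_structure M E \<rho> g S L r"
    and "\<forall>s\<in>carrier S. \<exists>V \<sigma> U \<psi>.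
           s \<in> V \<and> local_frame S (restrict_bundle E S) L r V \<sigma> \<and>
           openin (mtop M) U \<and> V \<subseteq> U \<and>
           (\<forall>\<mu><r. \<psi> \<mu> \<in> sections M E U \<and> restr V (\<psi> \<mu>) = \<sigma> \<mu>) \<and>
           (\<forall>\<mu><r. \<forall>\<nu><r. local_bracket M E br U (\<psi> \<mu>) (\<psi> \<nu>) \<in> sections_into M E S L U)"
  shows "involutive_structure M E \<rho> g br S L r"
proof -
  interpret courant M E \<rho> g br by unfold_locales (rule assms(1))
  have S: "submanifold M S" using assms(2) by (simp add: almost_involutive_structure_def)
  have SM: "carrier S \<subseteq> carrier M" using S by (simp add: submanifold_def)
  have "br \<phi> \<phi>' \<in> sections_into M E S L (carrier M)"
    if \<phi>: "\<phi> \<in> sections_into M E S L (carrier M)" and \<phi>': "\<phi>' \<in> sections_into M E S L (carrier M)" for \<phi> \<phi>'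
  proof -
    have sec: "\<phi> \<in> \<Gamma>" "\<phi>' \<in> \<Gamma>" using \<phi> \<phi>' by (simp_all add: sections_into_def)
    have val: "\<forall>y\<in>carrier S. \<phi> y \<in> L y" "\<forall>y\<in>carrier S. \<phi>' y \<in> L y"
      using \<phi> \<phi>' SM by (auto simp: sections_into_def subbundle_sections_def restr_def)
    have "br \<phi> \<phi>' s \<in> L s" if s: "s \<in> carrier S" for s
    proof -
      obtain V \<sigma> U \<psi> where d: "s \<in> V" "local_frame S (restrict_bundle E S) L r V \<sigma>"
        "openin (mtop M) U" "V \<subseteq> U"
        "\<forall>\<mu><r. \<psi> \<mu> \<in> sections M E U \<and> restr V (\<psi> \<mu>) = \<sigma> \<mu>"
        "\<forall>\<mu><r. \<forall>\<nu><r. local_bracket M E br U (\<psi> \<mu>) (\<psi> \<nu>) \<in> sections_into M E S L U"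
        using bspec[OF assms(3) s] by (elim exE conjE)
      obtain N \<Psi> where N: "openin (mtop M) N" "s \<in> N" "N \<subseteq> U" "N \<inter> carrier S \<subseteq> V"
        "\<forall>\<mu><r. \<Psi> \<mu> \<in> \<Gamma> \<and> (\<forall>y\<in>N. \<Psi> \<mu> y = \<psi> \<mu> y)"
        by (rule globalise_frame[OF S d(1-5)])
      have \<Psi>\<sigma>: "\<Psi> \<mu> y = \<sigma> \<mu> y" if "\<mu> < r" "y \<in> N" "y \<in> carrier S" for \<mu> y
      proof -
        have "y \<in> V" using N(4) that(2,3) by blast
        moreover have "restr V (\<psi> \<mu>) y = \<sigma> \<mu> y" using d(5) that(1) by simp
        ultimately have "\<sigma> \<mu> y = \<psi> \<mu> y" by (simp add: restr_def)
        then show ?thesis using N(5) that(1,2) by simp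
      qed
      have image: "(\<lambda>\<mu>. \<Psi> \<mu> y) ` {..<r} = (\<lambda>\<mu>. \<sigma> \<mu> y) ` {..<r}" if "y \<in> N" "y \<in> carrier S" for y
        using \<Psi>\<sigma>[OF _ that] by (intro image_cong) auto
      have "inj_on (\<lambda>\<mu>. \<sigma> \<mu> s) {..<r}" using d(1,2) by (simp add: local_frame_def)
      then have inj: "inj_on (\<lambda>\<mu>. \<Psi> \<mu> s) {..<r}"
        using \<Psi>\<sigma>[OF _ N(2) s] by (simp add: inj_on_def)
      have "independent ((\<lambda>\<mu>. \<sigma> \<mu> s) ` {..<r})" using d(1,2) by (simp add: local_frame_def)
      then have ind: "independent ((\<lambda>\<mu>. \<Psi> \<mu> s) ` {..<r})" unfolding image[OF N(2) s] .
      have span: "span ((\<lambda>\<mu>. \<Psi> \<mu> y) ` {..<r}) = L y" if y: "y \<in> N" "y \<in> carrier S" for y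
      proof -
        have "y \<in> V" using N(4) y by blast
        then show ?thesis using d(2) unfolding image[OF y] by (simp add: local_frame_def)
      qed
      have "br (\<Psi> \<mu>) (\<Psi> \<nu>) s \<in> L s" if "\<mu> < r" "\<nu> < r" for \<mu> \<nu>
      proof -
        have "local_bracket M E br U (\<psi> \<mu>) (\<psi> \<nu>) s = br (\<Psi> \<mu>) (\<Psi> \<nu>) s"
          by (rule local_bracket_eq[OF _ _ N(1-3)]) (use N(5) that in auto)
        moreover have "local_bracket M E br U (\<psi> \<mu>) (\<psi> \<nu>) s \<in> L s"
        proof -
          have "local_bracket M E br U (\<psi> \<mu>) (\<psi> \<nu>) \<in> sections_into M E S L U" using d(6) that by blast
          moreover have "s \<in> U \<inter> carrier S" using d(1,4) s by blast
          ultimately show ?thesis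
            by (auto simp: sections_into_def subbundle_sections_def restr_def)
        qed
        ultimately show ?thesis by simp
      qed
      then show ?thesis
        using bracket_in_subbundle_at[OF assms(2) s N(1,2) _ inj ind span _ sec(1) val(1) sec(2) val(2)] N(5)
        by blast
    qed
    then show ?thesis
      using restrict_section[OF S bracket_section[OF sec]] bracket_section[OF sec]
      by (simp add: sections_into_def subbundle_sections_def restr_def)
  qed
  then show ?thesis using assms(2) by (simp add: involutive_structure_def involutive_def)
qed

end
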